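(* There exist a Riemannian metric $g$ and a symplectic form $\sigma$ on $S^2$ such that the magnetic system $(S^2,g,\sigma)$ has an energy level $\Sigma_c$, $c>0$, which is not of contact type.
   Context: Let $\pi:TS^2\to S^2$ be the tangent bundle, $\alpha_{(x,v)}(\xi)=g_x(v,d\pi\,\xi)$, $E(x,v)=\frac12g_x(v,v)$, $\Sigma_c=\{E=c\}$. The level $\Sigma_c$ is of contact type if the 2-form $(d\alpha-\pi^*\sigma)|_{\Sigma_c}$ has a primitive $\tau\in\Omega^1(\Sigma_c)$ which is a contact form. *)

theory Defs
  imports "HOL-Analysis.Analysis"
begin

text \<open>
  Manifolds are embedded submanifolds \<open>M\<close> of a Euclidean space \<open>'a\<close>.  A tensor field on \<open>M\<close> is
  a function of a point and of ambient vectors; only its values at points of \<open>M\<close> and on vectors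
  tangent to \<open>M\<close> are meaningful, and the notions on \<open>M\<close> do not depend on the others.  Smoothness
  on \<open>M\<close> means that there are smooth local extensions to open subsets of \<open>'a\<close>.
\<close>

primrec Ck_on ::
  "nat \<Rightarrow> 'a::real_normed_vector set \<Rightarrow> ('a \<Rightarrow> 'b::real_normed_vector) \<Rightarrow> bool" where
  "Ck_on 0 U f \<longleftrightarrow> continuous_on U f"
| "Ck_on (Suc k) U f \<longleftrightarrow>
     (\<forall>x\<in>U. f differentiable (at x)) \<and>
     (\<forall>v. Ck_on k U (\<lambda>x. frechet_derivative f (at x) v))"

text \<open>To be used for open \<open>U\<close> only.\<close>

definition smooth_on ::
  "'a::real_normed_vector set \<Rightarrow> ('a \<Rightarrow> 'b::real_normed_vector) \<Rightarrow> bool" where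
  "smooth_on U f \<longleftrightarrow> (\<forall>k. Ck_on k U f)"

definition tangent_space :: "'a::euclidean_space set \<Rightarrow> 'a \<Rightarrow> 'a set" where
  "tangent_space M p =
     {\<xi>. \<exists>\<gamma> \<epsilon>. \<epsilon> > (0::real) \<and> smooth_on {-\<epsilon><..<\<epsilon>} \<gamma> \<and> (\<forall>t\<in>{-\<epsilon><..<\<epsilon>}. \<gamma> t \<in> M) \<and>
            \<gamma> 0 = p \<and> (\<gamma> has_vector_derivative \<xi>) (at 0)}"

definition tangent_bundle :: "'a::euclidean_space set \<Rightarrow> ('a \<times> 'a) set" where
  "tangent_bundle M = {(x, v). x \<in> M \<and> v \<in> tangent_space M x}"

definition extends_1form ::
  "'a::euclidean_space set \<Rightarrow> 'a \<Rightarrow> ('a \<Rightarrow> 'a \<Rightarrow> real) \<Rightarrow> ('a \<Rightarrow> 'a \<Rightarrow> real) \<Rightarrow> bool" where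
  "extends_1form M p \<tau> \<tau>' \<longleftrightarrow>
     (\<exists>U. open U \<and> p \<in> U \<and>
        (\<forall>q\<in>U. linear (\<tau>' q)) \<and> (\<forall>v. smooth_on U (\<lambda>q. \<tau>' q v)) \<and>
        (\<forall>q\<in>U \<inter> M. \<forall>\<xi>\<in>tangent_space M q. \<tau>' q \<xi> = \<tau> q \<xi>))"

definition extends_bilinear ::
  "'a::euclidean_space set \<Rightarrow> 'a \<Rightarrow> ('a \<Rightarrow> 'a \<Rightarrow> 'a \<Rightarrow> real) \<Rightarrow> ('a \<Rightarrow> 'a \<Rightarrow> 'a \<Rightarrow> real) \<Rightarrow> bool" where
  "extends_bilinear M p b b' \<longleftrightarrow>
     (\<exists>U. open U \<and> p \<in> U \<and>
        (\<forall>q\<in>U. bilinear (b' q)) \<and> (\<forall>v w. smooth_on U (\<lambda>q. b' q v w)) \<and>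
        (\<forall>q\<in>U \<inter> M. \<forall>\<xi>\<in>tangent_space M q. \<forall>\<eta>\<in>tangent_space M q. b' q \<xi> \<eta> = b q \<xi> \<eta>))"

definition extends_2form ::
  "'a::euclidean_space set \<Rightarrow> 'a \<Rightarrow> ('a \<Rightarrow> 'a \<Rightarrow> 'a \<Rightarrow> real) \<Rightarrow> ('a \<Rightarrow> 'a \<Rightarrow> 'a \<Rightarrow> real) \<Rightarrow> bool" where
  "extends_2form M p \<omega> \<omega>' \<longleftrightarrow>
     extends_bilinear M p \<omega> \<omega>' \<and> (\<forall>q v. \<omega>' q v v = 0)"

definition one_form :: "'a::euclidean_space set \<Rightarrow> ('a \<Rightarrow> 'a \<Rightarrow> real) \<Rightarrow> bool" where
  "one_form M \<tau> \<longleftrightarrow> (\<forall>p\<in>M. \<exists>\<tau>'. extends_1form M p \<tau> \<tau>')"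

definition two_form :: "'a::euclidean_space set \<Rightarrow> ('a \<Rightarrow> 'a \<Rightarrow> 'a \<Rightarrow> real) \<Rightarrow> bool" where
  "two_form M \<omega> \<longleftrightarrow> (\<forall>p\<in>M. \<exists>\<omega>'. extends_2form M p \<omega> \<omega>')"

definition riemannian_metric :: "'a::euclidean_space set \<Rightarrow> ('a \<Rightarrow> 'a \<Rightarrow> 'a \<Rightarrow> real) \<Rightarrow> bool" where
  "riemannian_metric M g \<longleftrightarrow>
     (\<forall>p\<in>M. \<exists>g'. extends_bilinear M p g g') \<and>
     (\<forall>p\<in>M. \<forall>\<xi>\<in>tangent_space M p. \<forall>\<eta>\<in>tangent_space M p. g p \<xi> \<eta> = g p \<eta> \<xi>) \<and>
     (\<forall>p\<in>M. \<forall>\<xi>\<in>tangent_space M p. \<xi> \<noteq> 0 \<longrightarrow> g p \<xi> \<xi> > 0)"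

text \<open>
  On an open set the exterior derivative is
  \<open>d\<tau>(\<xi>,\<eta>) = D\<^sub>\<xi>(\<tau>(\<eta>)) - D\<^sub>\<eta>(\<tau>(\<xi>))\<close> for constant \<open>\<xi>\<close>, \<open>\<eta>\<close>, and similarly for 2-forms.  On a submanifold
  it is computed with a smooth local extension near the point; as \<open>d\<close> commutes with the pullback
  along the inclusion, its values on tangent vectors do not depend on the extension chosen.
\<close>

definition d1 :: "('a::euclidean_space \<Rightarrow> 'a \<Rightarrow> real) \<Rightarrow> 'a \<Rightarrow> 'a \<Rightarrow> 'a \<Rightarrow> real" where
  "d1 \<tau> p \<xi> \<eta> =
     frechet_derivative (\<lambda>q. \<tau> q \<eta>) (at p) \<xi> - frechet_derivative (\<lambda>q. \<tau> q \<xi>) (at p) \<eta>"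

definition d2 :: "('a::euclidean_space \<Rightarrow> 'a \<Rightarrow> 'a \<Rightarrow> real) \<Rightarrow> 'a \<Rightarrow> 'a \<Rightarrow> 'a \<Rightarrow> 'a \<Rightarrow> real" where
  "d2 \<omega> p \<xi> \<eta> \<zeta> =
     frechet_derivative (\<lambda>q. \<omega> q \<eta> \<zeta>) (at p) \<xi> +
     frechet_derivative (\<lambda>q. \<omega> q \<zeta> \<xi>) (at p) \<eta> +
     frechet_derivative (\<lambda>q. \<omega> q \<xi> \<eta>) (at p) \<zeta>"

definition d1_on ::
  "'a::euclidean_space set \<Rightarrow> ('a \<Rightarrow> 'a \<Rightarrow> real) \<Rightarrow> 'a \<Rightarrow> 'a \<Rightarrow> 'a \<Rightarrow> real" where
  "d1_on M \<tau> p = d1 (SOME \<tau>'. extends_1form M p \<tau> \<tau>') p"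

definition d2_on ::
  "'a::euclidean_space set \<Rightarrow> ('a \<Rightarrow> 'a \<Rightarrow> 'a \<Rightarrow> real) \<Rightarrow> 'a \<Rightarrow> 'a \<Rightarrow> 'a \<Rightarrow> 'a \<Rightarrow> real" where
  "d2_on M \<omega> p = d2 (SOME \<omega>'. extends_2form M p \<omega> \<omega>') p"

definition symplectic_form :: "'a::euclidean_space set \<Rightarrow> ('a \<Rightarrow> 'a \<Rightarrow> 'a \<Rightarrow> real) \<Rightarrow> bool" where
  "symplectic_form M \<omega> \<longleftrightarrow>
     two_form M \<omega> \<and>
     (\<forall>p\<in>M. \<forall>\<xi>\<in>tangent_space M p. \<forall>\<eta>\<in>tangent_space M p. \<forall>\<zeta>\<in>tangent_space M p.
        d2_on M \<omega> p \<xi> \<eta> \<zeta> = 0) \<and>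
     (\<forall>p\<in>M. \<forall>\<xi>\<in>tangent_space M p. (\<forall>\<eta>\<in>tangent_space M p. \<omega> p \<xi> \<eta> = 0) \<longrightarrow> \<xi> = 0)"

text \<open>Contact forms on a 3-manifold: \<open>\<tau> \<and> d\<tau>\<close> vanishes nowhere.\<close>

definition contact_form :: "'a::euclidean_space set \<Rightarrow> ('a \<Rightarrow> 'a \<Rightarrow> real) \<Rightarrow> bool" where
  "contact_form M \<tau> \<longleftrightarrow>
     one_form M \<tau> \<and>
     (\<forall>p\<in>M. \<exists>\<xi>\<in>tangent_space M p. \<exists>\<eta>\<in>tangent_space M p. \<exists>\<zeta>\<in>tangent_space M p.
        \<tau> p \<xi> * d1_on M \<tau> p \<eta> \<zeta> + \<tau> p \<eta> * d1_on M \<tau> p \<zeta> \<xi> + \<tau> p \<zeta> * d1_on M \<tau> p \<xi> \<eta> \<noteq> 0)"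

type_synonym R3 = "real^3"

abbreviation S2 :: "R3 set" where
  "S2 \<equiv> sphere 0 1"

abbreviation TS2 :: "(R3 \<times> R3) set" where
  "TS2 \<equiv> tangent_bundle S2"

text \<open>The footpoint projection is the restriction to \<open>TS2\<close> of the linear map \<open>fst\<close>.\<close>

definition d\<pi> :: "R3 \<times> R3 \<Rightarrow> R3 \<times> R3 \<Rightarrow> R3" where
  "d\<pi> p = frechet_derivative fst (at p)"

lemma d\<pi>_eq_fst [simp]: "d\<pi> p = fst"
  unfolding d\<pi>_def
  by (rule frechet_derivative_at[symmetric]) (rule bounded_linear_imp_has_derivative[OF bounded_linear_fst])

definition liouville_form ::
  "(R3 \<Rightarrow> R3 \<Rightarrow> R3 \<Rightarrow> real) \<Rightarrow> R3 \<times> R3 \<Rightarrow> R3 \<times> R3 \<Rightarrow> real" where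
  "liouville_form g p \<xi> = g (fst p) (snd p) (d\<pi> p \<xi>)"

definition \<pi>_pullback ::
  "(R3 \<Rightarrow> R3 \<Rightarrow> R3 \<Rightarrow> real) \<Rightarrow>
   R3 \<times> R3 \<Rightarrow> R3 \<times> R3 \<Rightarrow> R3 \<times> R3 \<Rightarrow> real" where
  "\<pi>_pullback \<sigma> p \<xi> \<eta> = \<sigma> (fst p) (d\<pi> p \<xi>) (d\<pi> p \<eta>)"

definition energy :: "(R3 \<Rightarrow> R3 \<Rightarrow> R3 \<Rightarrow> real) \<Rightarrow> R3 \<times> R3 \<Rightarrow> real" where
  "energy g p = g (fst p) (snd p) (snd p) / 2"

definition energy_level ::
  "(R3 \<Rightarrow> R3 \<Rightarrow> R3 \<Rightarrow> real) \<Rightarrow> real \<Rightarrow> (R3 \<times> R3) set" where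
  "energy_level g c = {p \<in> TS2. energy g p = c}"

definition contact_type ::
  "(R3 \<Rightarrow> R3 \<Rightarrow> R3 \<Rightarrow> real) \<Rightarrow> (R3 \<Rightarrow> R3 \<Rightarrow> R3 \<Rightarrow> real) \<Rightarrow> real \<Rightarrow> bool" where
  "contact_type g \<sigma> c \<longleftrightarrow>
     (\<exists>\<tau>. one_form (energy_level g c) \<tau> \<and>
          (\<forall>p\<in>energy_level g c. \<forall>\<xi>\<in>tangent_space (energy_level g c) p.
             \<forall>\<eta>\<in>tangent_space (energy_level g c) p.
               d1_on (energy_level g c) \<tau> p \<xi> \<eta> =
               d1_on TS2 (liouville_form g) p \<xi> \<eta> - \<pi>_pullback \<sigma> p \<xi> \<eta>) \<and>
          contact_form (energy_level g c) \<tau>)"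

end

theory Submission imports Defs
begin

text \<open>
  Take the round metric and a rotationally invariant magnetic field \<open>\<sigma> = f(x\<^sub>3) dA\<close> that is concentrated near
  the north pole.  If \<open>\<tau>\<close> is a contact primitive of \<open>\<omega> = d\<alpha> - \<pi>\<^sup>*\<sigma>\<close> on the energy level, then \<open>\<tau>\<close> does not
  vanish on the kernel of \<open>\<omega>\<close>, so the integral of \<open>\<tau>\<close> over a closed characteristic is not zero.  The curves
  of constant latitude, traversed eastwards with speed \<open>u\<close>, are the orbits of the rotation in the level.
  Stokes' theorem on the cylinder that they sweep out from the north to the south pole gives the integral
  over each of them up to a constant.  The two boundary circles are fibres of the level with opposite
  orientations; as \<open>\<omega>\<close> integrates to zero over the cylinder of fibres above a meridian, their integrals are
  opposite, which fixes the constant: for the colatitude \<open>s\<close> the integral is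
  \<open>2 \<pi> (u sin s + F(cos s) - (F(1) + F(-1)) / 2)\<close> with \<open>F' = f\<close>.  The field and \<open>u\<close> are chosen such that the
  latitude \<open>cos s = 1/5\<close> is a characteristic, i.e. \<open>u cos s = f(cos s) sin s\<close>, of integral zero.
\<close>

section \<open>Smooth maps\<close>

text \<open>Since \<open>U\<close> is open, derivatives at its points depend only on the values in
  \<open>U\<close>, so the equality passes to all directional derivatives.\<close>

lemma Ck_on_cong:
  assumes "open U" "\<And>x. x \<in> U \<Longrightarrow> f x = g x" "Ck_on k U f"
  shows "Ck_on k U g"
  using assms(2,3)
proof (induction k arbitrary: f g)
  case 0
  then show ?case using continuous_on_eq by force
next
  case (Suc k)
  have d: "(g has_derivative frechet_derivative f (at x)) (at x)" if "x \<in> U" for x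
    using Suc.prems that \<open>open U\<close>
    using has_derivative_transform_within_open[of f _ x UNIV U g] frechet_derivative_works by fastforce
  have e: "frechet_derivative f (at x) v = frechet_derivative g (at x) v" if "x \<in> U" for x v
    using frechet_derivative_at[OF d[OF that]] by simp
  have "Ck_on k U (\<lambda>x. frechet_derivative g (at x) v)" for v
    by (rule Suc.IH[of "\<lambda>x. frechet_derivative f (at x) v"]) (use e Suc.prems in auto)
  then show ?case using d by (auto simp: differentiable_def)
qed

lemma Ck_on_SucD: "Ck_on (Suc k) U f \<Longrightarrow> Ck_on k U f"
proof (induction k arbitrary: f)
  case 0
  then show ?case
    by (simp add: continuous_at_imp_continuous_on differentiable_imp_continuous_within)
next
  case (Suc k)
  then show ?case by (metis Ck_on.simps(2))
qed

lemma Ck_on_local: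
  assumes "\<And>x. x \<in> U \<Longrightarrow> \<exists>V. open V \<and> x \<in> V \<and> Ck_on k V f"
  shows "Ck_on k U f"
  using assms
proof (induction k arbitrary: f)
  case 0
  show ?case
    unfolding Ck_on.simps(1)
  proof (rule continuous_at_imp_continuous_on, rule ballI)
    fix x assume "x \<in> U"
    from 0[OF this] obtain V where "open V" "x \<in> V" "continuous_on V f" by auto
    then show "isCont f x" using continuous_on_eq_continuous_at by blast
  qed
next
  case (Suc k)
  have "f differentiable (at x)" if "x \<in> U" for x
    using Suc.prems[OF that] by auto
  moreover have "Ck_on k U (\<lambda>x. frechet_derivative f (at x) v)" for v
  proof (rule Suc.IH)
    fix x assume "x \<in> U"
    from Suc.prems[OF this] obtain V where "open V" "x \<in> V" "Ck_on (Suc k) V f" by blast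
    then show "\<exists>V. open V \<and> x \<in> V \<and> Ck_on k V (\<lambda>x. frechet_derivative f (at x) v)" by auto
  qed
  ultimately show ?case by simp
qed

lemma Ck_on_subset:
  assumes "U \<subseteq> V"
  shows "Ck_on k V f \<Longrightarrow> Ck_on k U f"
proof (induction k arbitrary: f)
  case 0
  then show ?case using assms by (simp add: continuous_on_subset)
next
  case (Suc k)
  then show ?case using assms by (simp add: subset_iff)
qed

lemma Ck_on_const: "Ck_on k U (\<lambda>x. c)"
  by (induction k arbitrary: c) simp_all

text \<open>Lets an explicit derivative replace the choice hidden in
  \<open>frechet_derivative\<close>; uniqueness of derivatives identifies the two.\<close>

lemma Ck_on_SucI:
  assumes "open U" "\<And>x. x \<in> U \<Longrightarrow> (f has_derivative f' x) (at x)"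
    and "\<And>v. Ck_on k U (\<lambda>x. f' x v)"
  shows "Ck_on (Suc k) U f"
proof -
  have "Ck_on k U (\<lambda>x. frechet_derivative f (at x) v)" for v
    by (rule Ck_on_cong[OF assms(1) _ assms(3)[of v]])
       (simp add: frechet_derivative_at[OF assms(2), symmetric])
  moreover have "f differentiable (at x)" if "x \<in> U" for x
    using assms(2)[OF that] differentiableI by blast
  ultimately show ?thesis by simp
qed

lemma Ck_on_SucD_derivative:
  assumes "Ck_on (Suc k) U f"
  shows "x \<in> U \<Longrightarrow> (f has_derivative frechet_derivative f (at x)) (at x)"
    and "Ck_on k U (\<lambda>x. frechet_derivative f (at x) v)"
  using assms by (auto simp flip: frechet_derivative_works)

lemma Ck_on_bounded_linear:
  assumes "bounded_linear f" "open U"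
  shows "Ck_on k U f"
proof (cases k)
  case 0
  then show ?thesis using assms by (simp add: linear_continuous_on)
next
  case (Suc j)
  show ?thesis unfolding Suc
    by (rule Ck_on_SucI[OF assms(2), where f' = "\<lambda>x. f"])
       (simp_all add: assms(1) bounded_linear_imp_has_derivative Ck_on_const)
qed

lemma Ck_on_add:
  assumes "open U" "Ck_on k U f" "Ck_on k U g"
  shows "Ck_on k U (\<lambda>x. f x + g x)"
  using assms(2,3)
proof (induction k arbitrary: f g)
  case 0
  then show ?case by (simp add: continuous_on_add)
next
  case (Suc k)
  note f = Ck_on_SucD_derivative[OF Suc.prems(1)] and g = Ck_on_SucD_derivative[OF Suc.prems(2)]
  show ?case
    by (rule Ck_on_SucI[OF \<open>open U\<close> has_derivative_add[OF f(1) g(1)] Suc.IH[OF f(2) g(2)]])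
qed

lemma Ck_on_sum:
  assumes "open U" "\<And>i. i \<in> I \<Longrightarrow> Ck_on k U (f i)"
  shows "Ck_on k U (\<lambda>x. \<Sum>i\<in>I. f i x)"
  using assms(2)
  by (induction I rule: infinite_finite_induct) (simp_all add: Ck_on_const Ck_on_add[OF assms(1)])

lemma Ck_on_bounded_bilinear:
  assumes "bounded_bilinear p" "open U" "Ck_on k U f" "Ck_on k U g"
  shows "Ck_on k U (\<lambda>x. p (f x) (g x))"
  using assms(3,4)
proof (induction k arbitrary: f g)
  case 0
  then show ?case using bounded_bilinear.continuous_on[OF assms(1)] by simp
next
  case (Suc k)
  note f = Ck_on_SucD_derivative[OF Suc.prems(1)] and g = Ck_on_SucD_derivative[OF Suc.prems(2)]
  show ?case
    by (rule Ck_on_SucI[OF \<open>open U\<close> bounded_bilinear.FDERIV[OF assms(1) f(1) g(1)]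
          Ck_on_add[OF \<open>open U\<close> Suc.IH[OF Ck_on_SucD[OF Suc.prems(1)] g(2)]
            Suc.IH[OF f(2) Ck_on_SucD[OF Suc.prems(2)]]]])
qed

text \<open>The chain rule applies the derivative of \<open>f\<close> to a direction that varies
  with \<open>x\<close>, whereas \<open>Ck_on\<close> speaks of fixed directions. Expanding the
  direction in \<open>Basis\<close> gives a sum of products to which the induction hypothesis
  applies; hence the Euclidean middle space.\<close>

lemma Ck_on_compose:
  fixes \<phi> :: "'a::real_normed_vector \<Rightarrow> 'b::euclidean_space" and f :: "'b \<Rightarrow> 'c::real_normed_vector"
  assumes "open U" "open V" "\<phi> ` U \<subseteq> V" "Ck_on k U \<phi>" "Ck_on k V f"
  shows "Ck_on k U (\<lambda>x. f (\<phi> x))"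
  using assms(4,5)
proof (induction k arbitrary: f)
  case 0
  then show ?case using continuous_on_compose2[of V f U \<phi>] assms(3) by simp
next
  case (Suc k)
  note \<phi> = Ck_on_SucD_derivative[OF Suc.prems(1)] and f = Ck_on_SucD_derivative[OF Suc.prems(2)]
  show ?case
  proof (rule Ck_on_SucI[OF \<open>open U\<close>])
    fix x assume x: "x \<in> U"
    let ?w = "frechet_derivative \<phi> (at x)"
    have lin: "linear (frechet_derivative f (at (\<phi> x)))"
      using f(1) assms(3) x has_derivative_linear by blast
    have "((\<lambda>x. f (\<phi> x)) has_derivative (\<lambda>v. frechet_derivative f (at (\<phi> x)) (?w v))) (at x)"
      using has_derivative_compose[OF \<phi>(1)[OF x] f(1)] assms(3) x by auto
    moreover have "frechet_derivative f (at (\<phi> x)) (?w v)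
       = (\<Sum>b\<in>Basis. (?w v \<bullet> b) *\<^sub>R frechet_derivative f (at (\<phi> x)) b)" for v
      by (subst euclidean_representation[of "?w v", symmetric])
         (simp only: linear_sum[OF lin] linear_cmul[OF lin])
    ultimately show "((\<lambda>x. f (\<phi> x)) has_derivative
        (\<lambda>v. \<Sum>b\<in>Basis. (?w v \<bullet> b) *\<^sub>R frechet_derivative f (at (\<phi> x)) b)) (at x)"
      by simp
  next
    fix v
    show "Ck_on k U (\<lambda>x. \<Sum>b\<in>Basis. (frechet_derivative \<phi> (at x) v \<bullet> b) *\<^sub>R
              frechet_derivative f (at (\<phi> x)) b)"
      by (intro Ck_on_sum Ck_on_bounded_bilinear[OF bounded_bilinear_scaleR]
          Ck_on_bounded_bilinear[OF bounded_bilinear_inner] Ck_on_const assms(1) \<phi>(2) f(2) Suc.IH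
          Ck_on_SucD[OF Suc.prems(1)])
  qed
qed

section \<open>Closure properties of smooth functions\<close>

lemma smooth_on_const: "smooth_on U (\<lambda>x. c)"
  by (simp add: smooth_on_def Ck_on_const)

lemma smooth_on_bounded_linear: "bounded_linear f \<Longrightarrow> open U \<Longrightarrow> smooth_on U f"
  by (simp add: smooth_on_def Ck_on_bounded_linear)

lemma smooth_on_add:
  "open U \<Longrightarrow> smooth_on U f \<Longrightarrow> smooth_on U g \<Longrightarrow> smooth_on U (\<lambda>x. f x + g x)"
  by (simp add: smooth_on_def Ck_on_add)

lemma smooth_on_sum:
  "open U \<Longrightarrow> (\<And>i. i \<in> I \<Longrightarrow> smooth_on U (f i)) \<Longrightarrow> smooth_on U (\<lambda>x. \<Sum>i\<in>I. f i x)"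
  by (simp add: smooth_on_def Ck_on_sum)

lemma smooth_on_bounded_bilinear:
  "bounded_bilinear p \<Longrightarrow> open U \<Longrightarrow> smooth_on U f \<Longrightarrow> smooth_on U g \<Longrightarrow> smooth_on U (\<lambda>x. p (f x) (g x))"
  by (simp add: smooth_on_def Ck_on_bounded_bilinear)

lemmas smooth_on_inner = smooth_on_bounded_bilinear[OF bounded_bilinear_inner]
lemmas smooth_on_mult = smooth_on_bounded_bilinear[OF bounded_bilinear_mult]
lemmas smooth_on_scaleR = smooth_on_bounded_bilinear[OF bounded_bilinear_scaleR]

lemma smooth_on_compose:
  fixes \<phi> :: "'a::real_normed_vector \<Rightarrow> 'b::euclidean_space"
  shows "open U \<Longrightarrow> open V \<Longrightarrow> \<phi> ` U \<subseteq> V \<Longrightarrow> smooth_on U \<phi> \<Longrightarrow> smooth_on V f \<Longrightarrow>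
    smooth_on U (\<lambda>x. f (\<phi> x))"
  by (simp add: smooth_on_def Ck_on_compose)

lemma smooth_on_subset: "smooth_on V f \<Longrightarrow> U \<subseteq> V \<Longrightarrow> smooth_on U f"
  by (simp add: smooth_on_def Ck_on_subset[of U V])

lemma smooth_on_cong:
  "open U \<Longrightarrow> (\<And>x. x \<in> U \<Longrightarrow> f x = g x) \<Longrightarrow> smooth_on U f \<Longrightarrow> smooth_on U g"
  unfolding smooth_on_def using Ck_on_cong by metis

lemma smooth_on_local:
  "(\<And>x. x \<in> U \<Longrightarrow> \<exists>V. open V \<and> x \<in> V \<and> smooth_on V f) \<Longrightarrow> smooth_on U f"
  unfolding smooth_on_def using Ck_on_local by metis

lemma smooth_on_has_derivative:
  "smooth_on U f \<Longrightarrow> x \<in> U \<Longrightarrow> (f has_derivative frechet_derivative f (at x)) (at x)"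
  unfolding smooth_on_def by (metis Ck_on_SucD_derivative)

lemma smooth_on_frechet_derivative:
  "smooth_on U f \<Longrightarrow> smooth_on U (\<lambda>x. frechet_derivative f (at x) v)"
  unfolding smooth_on_def by (metis Ck_on_SucD_derivative)

lemma smooth_on_imp_continuous_on: "smooth_on U f \<Longrightarrow> continuous_on U f"
  unfolding smooth_on_def by (metis Ck_on.simps(1))

text \<open>Each function is, up to sign, the derivative of the other, so both go through one
  induction.\<close>

lemma Ck_on_sin_cos: "Ck_on k UNIV (sin :: real \<Rightarrow> real) \<and> Ck_on k UNIV (cos :: real \<Rightarrow> real)"
proof (induction k)
  case 0
  then show ?case by (simp add: continuous_on_sin continuous_on_cos)
next
  case (Suc k)
  have "Ck_on (Suc k) UNIV (sin :: real \<Rightarrow> real)"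
    by (rule Ck_on_SucI[where f' = "\<lambda>x v. v * cos x"])
       (use Suc in \<open>auto intro!: derivative_eq_intros Ck_on_bounded_bilinear[OF bounded_bilinear_mult] Ck_on_const\<close>)
  moreover have "Ck_on k UNIV (\<lambda>x. - (v * sin x))" for v :: real
    using Ck_on_bounded_bilinear[OF bounded_bilinear_mult, of UNIV k "\<lambda>x. - v" sin] Suc
    by (simp add: Ck_on_const)
  then have "Ck_on (Suc k) UNIV (cos :: real \<Rightarrow> real)"
    by (intro Ck_on_SucI[where f' = "\<lambda>x v. - (v * sin x)"]) (auto intro!: derivative_eq_intros)
  ultimately show ?case by blast
qed

lemma smooth_on_sin_cos:
  fixes h :: "'a::real_normed_vector \<Rightarrow> real"
  assumes "open U" "smooth_on U h"
  shows smooth_on_sin: "smooth_on U (\<lambda>x. sin (h x))"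
    and smooth_on_cos: "smooth_on U (\<lambda>x. cos (h x))"
  using assms smooth_on_compose[of U UNIV h sin] smooth_on_compose[of U UNIV h cos] Ck_on_sin_cos
  by (auto simp: smooth_on_def)

section \<open>Smooth maps along lines and the symmetry of second derivatives\<close>

lemma smooth_on_has_vector_derivative:
  assumes "smooth_on UNIV f"
  shows "((\<lambda>t. f (p + t *\<^sub>R a)) has_vector_derivative frechet_derivative f (at (p + t *\<^sub>R a)) a) (at t within S)"
proof -
  have f: "(f has_derivative frechet_derivative f (at (p + t *\<^sub>R a))) (at (p + t *\<^sub>R a))"
    using smooth_on_has_derivative[OF assms] by simp
  have "((\<lambda>t. p + t *\<^sub>R a) has_derivative (\<lambda>h. h *\<^sub>R a)) (at t within S)"
    by (auto intro!: derivative_eq_intros)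
  from has_derivative_compose[OF this f] show ?thesis
    unfolding has_vector_derivative_def
    by (simp add: linear_cmul[OF has_derivative_linear[OF f]])
qed

lemma smooth_on_line:
  fixes f :: "'a::euclidean_space \<Rightarrow> 'b::real_normed_vector"
  assumes "smooth_on UNIV f"
  shows "smooth_on UNIV (\<lambda>t::real. f (p + t *\<^sub>R a))"
proof -
  have "smooth_on UNIV (\<lambda>t::real. p + t *\<^sub>R a)"
    by (intro smooth_on_add smooth_on_const smooth_on_bounded_linear bounded_linear_scaleR_left) auto
  from smooth_on_compose[OF _ _ _ this assms] show ?thesis by simp
qed

text \<open>The image of the line through \<open>z\<close> in direction \<open>a\<close> is a curve
  in \<open>M\<close> with this velocity. Tangent vectors of the energy level are exhibited in this
  way below.\<close>

lemma smooth_map_tangent: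
  fixes \<Phi> :: "'a::euclidean_space \<Rightarrow> 'b::euclidean_space"
  assumes "smooth_on UNIV \<Phi>" "range \<Phi> \<subseteq> M"
  shows "frechet_derivative \<Phi> (at z) a \<in> tangent_space M (\<Phi> z)"
proof -
  have "smooth_on {- 1<..<1} (\<lambda>t::real. \<Phi> (z + t *\<^sub>R a))"
    using smooth_on_subset[OF smooth_on_line[OF assms(1)]] by blast
  then show ?thesis
    unfolding tangent_space_def
    using assms(2) smooth_on_has_vector_derivative[OF assms(1), of z a 0]
    by (intro CollectI exI[of _ "\<lambda>t. \<Phi> (z + t *\<^sub>R a)"] exI[of _ 1]) auto
qed

text \<open>The increment of \<open>f\<close> along \<open>a\<close> is the integral of its
  \<open>a\<close>-derivative. Differentiating this identity in direction \<open>b\<close> under the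
  integral sign, and then in the length \<open>s\<close>, produces the two mixed
  derivatives.\<close>

lemma frechet_derivative_commute:
  fixes f :: "'a::euclidean_space \<Rightarrow> 'b::euclidean_space"
  assumes "smooth_on UNIV f"
  shows "frechet_derivative (\<lambda>x. frechet_derivative f (at x) a) (at z) b =
         frechet_derivative (\<lambda>x. frechet_derivative f (at x) b) (at z) a"
proof -
  define fa where "fa x = frechet_derivative f (at x) a" for x
  define fb where "fb x = frechet_derivative f (at x) b" for x
  define fab where "fab x = frechet_derivative fa (at x) b" for x
  define fba where "fba x = frechet_derivative fb (at x) a" for x
  note unf = fa_def[abs_def] fb_def[abs_def] fab_def[abs_def] fba_def[abs_def]
  have sm: "smooth_on UNIV fa" "smooth_on UNIV fb" "smooth_on UNIV fab"
    using assms by (simp_all add: unf smooth_on_frechet_derivative)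
  note cont = smooth_on_imp_continuous_on[OF sm(1)] smooth_on_imp_continuous_on[OF sm(3)]
  let ?p = "\<lambda>t \<sigma>. (z + t *\<^sub>R b) + \<sigma> *\<^sub>R a"
  have swap: "?p t \<sigma> = (z + \<sigma> *\<^sub>R a) + t *\<^sub>R b" for t \<sigma> by simp
  have ftc: "integral (cbox 0 s) (\<lambda>\<sigma>. fa (?p t \<sigma>)) = f (?p t s) - f (?p t 0)" if "0 \<le> s" for s t
    using fundamental_theorem_of_calculus[OF that, of "\<lambda>\<sigma>. f (?p t \<sigma>)" "\<lambda>\<sigma>. fa (?p t \<sigma>)"]
      smooth_on_has_vector_derivative[OF assms, of "z + t *\<^sub>R b" a]
    by (simp add: fa_def integral_unique)
  have eq: "integral (cbox 0 s) (\<lambda>\<sigma>. fab (?p 0 \<sigma>)) = fb (z + s *\<^sub>R a) - fb z" if "0 \<le> s" for s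
  proof -
    have "((\<lambda>t. integral (cbox 0 s) (\<lambda>\<sigma>. fa (?p t \<sigma>))) has_vector_derivative
            integral (cbox 0 s) (\<lambda>\<sigma>. fab (?p 0 \<sigma>))) (at 0 within UNIV)"
    proof (rule leibniz_rule_vector_derivative)
      fix t \<sigma> :: real
      show "((\<lambda>t. fa (?p t \<sigma>)) has_vector_derivative fab (?p t \<sigma>)) (at t within UNIV)"
        unfolding swap fab_def by (rule smooth_on_has_vector_derivative[OF sm(1)])
      show "(\<lambda>\<sigma>. fa (?p t \<sigma>)) integrable_on cbox 0 s"
        by (intro integrable_continuous continuous_on_compose2[OF cont(1)] continuous_intros) auto
    next
      show "continuous_on (UNIV \<times> cbox 0 s) (\<lambda>(t, \<sigma>). fab (?p t \<sigma>))"
        unfolding split_beta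
        by (intro continuous_on_compose2[OF cont(2)] continuous_intros) auto
    qed auto
    moreover have "((\<lambda>t. f (?p t s) - f (?p t 0)) has_vector_derivative fb (z + s *\<^sub>R a) - fb z) (at 0)"
      using has_vector_derivative_diff[OF smooth_on_has_vector_derivative[OF assms, of "z + s *\<^sub>R a" b 0 UNIV]
          smooth_on_has_vector_derivative[OF assms, of z b 0 UNIV]]
      by (simp add: fb_def swap)
    ultimately show ?thesis
      unfolding ftc[OF that] using vector_derivative_unique_at by blast
  qed
  \<comment> \<open>The identity \<open>eq\<close> is available for nonnegative \<open>s\<close>, so
    the derivatives at 0 are taken within \<open>{0..1}\<close>.\<close>
  have "((\<lambda>s. integral {0..s} (\<lambda>\<sigma>. fab (z + \<sigma> *\<^sub>R a))) has_vector_derivative fab (z + 0 *\<^sub>R a))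
      (at 0 within {0..1})"
    by (intro integral_has_vector_derivative continuous_on_compose2[OF cont(2)] continuous_intros) auto
  moreover have "((\<lambda>s. integral {0..s} (\<lambda>\<sigma>. fab (z + \<sigma> *\<^sub>R a))) has_vector_derivative fba z)
      (at 0 within {0..1})"
  proof (rule has_vector_derivative_transform)
    show "((\<lambda>s. fb (z + s *\<^sub>R a) - fb z) has_vector_derivative fba z) (at 0 within {0..1})"
      using smooth_on_has_vector_derivative[OF sm(2), of z a 0 "{0..1}"]
      by (simp add: fba_def has_vector_derivative_diff_const)
  qed (use eq in auto)
  ultimately have "fab z = fba z"
    using vector_derivative_unique_within_closed_interval[of 0 1 0] by fastforce
  then show ?thesis by (simp add: unf)
qed

section \<open>One-forms and their exterior derivative\<close>

definition smooth_1form_on ::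
  "'a::euclidean_space set \<Rightarrow> ('a \<Rightarrow> 'a \<Rightarrow> real) \<Rightarrow> bool" where
  "smooth_1form_on U \<tau> \<longleftrightarrow> open U \<and> (\<forall>q\<in>U. linear (\<tau> q)) \<and> (\<forall>v. smooth_on U (\<lambda>q. \<tau> q v))"

lemma smooth_1form_on_expand:
  assumes "smooth_1form_on U \<tau>" "q \<in> U"
  shows "\<tau> q w = (\<Sum>i\<in>Basis. (w \<bullet> i) * \<tau> q i)"
proof -
  have lin: "linear (\<tau> q)" using assms by (simp add: smooth_1form_on_def)
  show ?thesis
    by (subst euclidean_representation[of w, symmetric])
       (simp only: linear_sum[OF lin] linear_cmul[OF lin] real_scaleR_def)
qed

lemma smooth_1form_on_has_derivative_const:
  assumes "smooth_1form_on U \<tau>" "q \<in> U"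
  shows "((\<lambda>q. \<tau> q w) has_derivative frechet_derivative (\<lambda>q. \<tau> q w) (at q)) (at q)"
  using assms smooth_on_has_derivative by (fastforce simp: smooth_1form_on_def)

lemma smooth_1form_on_derivative_expand:
  assumes "smooth_1form_on U \<tau>" "q \<in> U"
  shows "frechet_derivative (\<lambda>q. \<tau> q w) (at q) h =
    (\<Sum>i\<in>Basis. (w \<bullet> i) * frechet_derivative (\<lambda>q. \<tau> q i) (at q) h)"
proof -
  have "((\<lambda>q. \<Sum>i\<in>Basis. (w \<bullet> i) * \<tau> q i) has_derivative
      (\<lambda>h. \<Sum>i\<in>Basis. (w \<bullet> i) * frechet_derivative (\<lambda>q. \<tau> q i) (at q) h)) (at q)"
    by (intro has_derivative_sum has_derivative_mult_right smooth_1form_on_has_derivative_const[OF assms])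
  moreover have "open U" using assms(1) by (simp add: smooth_1form_on_def)
  ultimately have "((\<lambda>q. \<tau> q w) has_derivative
      (\<lambda>h. \<Sum>i\<in>Basis. (w \<bullet> i) * frechet_derivative (\<lambda>q. \<tau> q i) (at q) h)) (at q)"
    by (rule has_derivative_transform_within_open[OF _ _ assms(2)])
       (simp add: smooth_1form_on_expand[OF assms(1)])
  then show ?thesis by (simp add: frechet_derivative_at[symmetric])
qed

text \<open>Product rule for a form evaluated along a map on a moving vector: in coordinates this is
  a sum of products, where one term differentiates the base point and the other the vector.\<close>

lemma smooth_1form_on_has_derivative:
  assumes \<tau>: "smooth_1form_on U \<tau>" and U: "\<phi> z \<in> U"
    and \<phi>: "(\<phi> has_derivative \<phi>') (at z)" and w: "(w has_derivative w') (at z)"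
  shows "((\<lambda>x. \<tau> (\<phi> x) (w x)) has_derivative
      (\<lambda>h. frechet_derivative (\<lambda>q. \<tau> q (w z)) (at (\<phi> z)) (\<phi>' h) + \<tau> (\<phi> z) (w' h))) (at z)"
proof -
  let ?D = "\<lambda>i. frechet_derivative (\<lambda>q. \<tau> q i) (at (\<phi> z))"
  have "open U" using \<tau> by (simp add: smooth_1form_on_def)
  have 1: "((\<lambda>x. \<Sum>i\<in>Basis. (w x \<bullet> i) * \<tau> (\<phi> x) i) has_derivative
      (\<lambda>h. \<Sum>i\<in>Basis. (w z \<bullet> i) * ?D i (\<phi>' h) + (w' h \<bullet> i) * \<tau> (\<phi> z) i)) (at z)"
    by (intro has_derivative_sum has_derivative_mult has_derivative_inner_left w
        has_derivative_compose[OF \<phi> smooth_1form_on_has_derivative_const[OF \<tau> U]])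
  have 2: "(\<lambda>h. \<Sum>i\<in>Basis. (w z \<bullet> i) * ?D i (\<phi>' h) + (w' h \<bullet> i) * \<tau> (\<phi> z) i) =
    (\<lambda>h. frechet_derivative (\<lambda>q. \<tau> q (w z)) (at (\<phi> z)) (\<phi>' h) + \<tau> (\<phi> z) (w' h))"
    by (simp only: sum.distrib smooth_1form_on_derivative_expand[OF \<tau> U, where w = "w z"]
        smooth_1form_on_expand[OF \<tau> U, where w = "w' h" for h])
  obtain V where V: "open V" "z \<in> V" "\<And>x. x \<in> V \<Longrightarrow> \<phi> x \<in> U"
    using has_derivative_continuous[OF \<phi>] \<open>open U\<close> U
    by (metis continuous_at_open)
  show ?thesis
    by (rule has_derivative_transform_within_open[OF 1[unfolded 2] V(1,2)])
       (rule smooth_1form_on_expand[OF \<tau> V(3), symmetric])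
qed

lemma bilinear_d1:
  assumes "smooth_1form_on U \<tau>" "p \<in> U"
  shows "bilinear (d1 \<tau> p)"
proof -
  let ?D = "\<lambda>w. frechet_derivative (\<lambda>q. \<tau> q w) (at p)"
  have l: "linear (?D w)" for w
    using has_derivative_linear[OF smooth_1form_on_has_derivative_const[OF assms]] .
  have r: "?D (v + w) h = ?D v h + ?D w h" "?D (c *\<^sub>R v) h = c * ?D v h" for v w h c
    by (simp_all add: smooth_1form_on_derivative_expand[OF assms, of "v + w"]
        smooth_1form_on_derivative_expand[OF assms, of "c *\<^sub>R v"]
        smooth_1form_on_derivative_expand[OF assms, of v]
        smooth_1form_on_derivative_expand[OF assms, of w]
        inner_add_left distrib_right sum.distrib sum_distrib_left mult.assoc)
  show ?thesis
    unfolding bilinear_def d1_def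
    by (intro conjI allI linearI)
       (simp_all add: r linear_add[OF l] linear_cmul[OF l] right_diff_distrib)
qed

lemma d1_skew: "d1 \<tau> p \<eta> \<xi> = - d1 \<tau> p \<xi> \<eta>"
  by (simp add: d1_def)

section \<open>Pullback of one-forms along smooth maps\<close>

lemma one_form_extension:
  assumes "one_form M \<tau>" "p \<in> M"
  obtains U \<tau>' where "smooth_1form_on U \<tau>'" "p \<in> U" "d1_on M \<tau> p = d1 \<tau>' p"
    "\<And>q \<xi>. q \<in> U \<inter> M \<Longrightarrow> \<xi> \<in> tangent_space M q \<Longrightarrow> \<tau> q \<xi> = \<tau>' q \<xi>"
proof -
  \<comment> \<open>The choice is the one made in \<open>d1_on_def\<close>, so that
    \<open>d1_on\<close> is literally \<open>d1\<close> of this extension.\<close>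
  define \<tau>' where "\<tau>' = (SOME \<tau>'. extends_1form M p \<tau> \<tau>')"
  have "\<exists>\<tau>'. extends_1form M p \<tau> \<tau>'"
    using assms unfolding one_form_def by blast
  then have "extends_1form M p \<tau> \<tau>'"
    unfolding \<tau>'_def by (rule someI_ex)
  then obtain U where U: "smooth_1form_on U \<tau>'" "p \<in> U"
    "\<And>q \<xi>. q \<in> U \<inter> M \<Longrightarrow> \<xi> \<in> tangent_space M q \<Longrightarrow> \<tau> q \<xi> = \<tau>' q \<xi>"
    unfolding extends_1form_def smooth_1form_on_def by force
  show thesis
    by (rule that[OF U(1,2) _ U(3)]) (simp_all add: d1_on_def \<tau>'_def)
qed

text \<open>The differential of \<Phi> takes values in tangent vectors of \<open>M\<close>, on which
  \<tau> agrees with its extension. Near \<open>z\<close> the pullback can therefore be computed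
  with a form on an open set.\<close>

lemma pullback_local:
  fixes \<Phi> :: "'e::euclidean_space \<Rightarrow> 'a::euclidean_space"
  assumes "one_form M \<tau>" and \<Phi>: "smooth_on UNIV \<Phi>" "range \<Phi> \<subseteq> M"
  obtains U \<tau>' V where "smooth_1form_on U \<tau>'" "d1_on M \<tau> (\<Phi> z) = d1 \<tau>' (\<Phi> z)"
    "open V" "z \<in> V" "\<Phi> ` V \<subseteq> U"
    "\<And>x a. x \<in> V \<Longrightarrow> \<tau>' (\<Phi> x) (frechet_derivative \<Phi> (at x) a) = \<tau> (\<Phi> x) (frechet_derivative \<Phi> (at x) a)"
proof -
  obtain U \<tau>' where U: "smooth_1form_on U \<tau>'" "\<Phi> z \<in> U" "d1_on M \<tau> (\<Phi> z) = d1 \<tau>' (\<Phi> z)"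
    and ext: "\<And>q \<xi>. q \<in> U \<inter> M \<Longrightarrow> \<xi> \<in> tangent_space M q \<Longrightarrow> \<tau> q \<xi> = \<tau>' q \<xi>"
    using one_form_extension[OF assms(1), of "\<Phi> z"] \<Phi>(2) by blast
  have "open (\<Phi> -` U)"
    using U(1) smooth_on_imp_continuous_on[OF \<Phi>(1)] by (auto simp: smooth_1form_on_def intro: open_vimage)
  show thesis
  proof (rule that[OF U(1,3) \<open>open (\<Phi> -` U)\<close>])
    fix x a assume "x \<in> \<Phi> -` U"
    moreover have "\<Phi> x \<in> M" using \<Phi>(2) by blast
    ultimately show "\<tau>' (\<Phi> x) (frechet_derivative \<Phi> (at x) a) = \<tau> (\<Phi> x) (frechet_derivative \<Phi> (at x) a)"
      using ext[of "\<Phi> x" "frechet_derivative \<Phi> (at x) a"] smooth_map_tangent[OF \<Phi>, of x a] by simp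
  qed (use U in auto)
qed

lemma smooth_pullback:
  fixes \<Phi> :: "'e::euclidean_space \<Rightarrow> 'a::euclidean_space"
  assumes "one_form M \<tau>" and \<Phi>: "smooth_on UNIV \<Phi>" "range \<Phi> \<subseteq> M"
  shows "smooth_on UNIV (\<lambda>z. \<tau> (\<Phi> z) (frechet_derivative \<Phi> (at z) a))"
proof (rule smooth_on_local)
  fix z
  obtain U \<tau>' V where U: "smooth_1form_on U \<tau>'" "d1_on M \<tau> (\<Phi> z) = d1 \<tau>' (\<Phi> z)"
    and V: "open V" "z \<in> V" "\<Phi> ` V \<subseteq> U"
    and eq: "\<And>x a. x \<in> V \<Longrightarrow> \<tau>' (\<Phi> x) (frechet_derivative \<Phi> (at x) a) = \<tau> (\<Phi> x) (frechet_derivative \<Phi> (at x) a)"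
    using pullback_local[OF assms, of z] by metis
  have sm: "smooth_on V (\<lambda>x. \<Sum>i\<in>Basis. (frechet_derivative \<Phi> (at x) a \<bullet> i) * \<tau>' (\<Phi> x) i)"
  proof (rule smooth_on_sum[OF V(1)])
    fix i :: 'a
    have "smooth_on V (\<lambda>x. frechet_derivative \<Phi> (at x) a \<bullet> i)"
      by (rule smooth_on_inner[OF V(1) smooth_on_subset[OF smooth_on_frechet_derivative[OF \<Phi>(1)] subset_UNIV]
            smooth_on_const])
    moreover have "smooth_on V (\<lambda>x. \<tau>' (\<Phi> x) i)"
      by (rule smooth_on_compose[OF V(1) _ V(3) smooth_on_subset[OF \<Phi>(1) subset_UNIV], where f = "\<lambda>q. \<tau>' q i"])
         (use U(1) in \<open>simp_all add: smooth_1form_on_def\<close>)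
    ultimately show "smooth_on V (\<lambda>x. (frechet_derivative \<Phi> (at x) a \<bullet> i) * \<tau>' (\<Phi> x) i)"
      by (rule smooth_on_mult[OF V(1)])
  qed
  have "smooth_on V (\<lambda>z. \<tau> (\<Phi> z) (frechet_derivative \<Phi> (at z) a))"
  proof (rule smooth_on_cong[OF V(1) _ sm])
    fix x assume "x \<in> V"
    with V(3) have "\<Phi> x \<in> U" by blast
    from smooth_1form_on_expand[OF U(1) this, symmetric] eq[OF \<open>x \<in> V\<close>, of a]
    show "(\<Sum>i\<in>Basis. (frechet_derivative \<Phi> (at x) a \<bullet> i) * \<tau>' (\<Phi> x) i) =
        \<tau> (\<Phi> x) (frechet_derivative \<Phi> (at x) a)" by (rule trans)
  qed
  with V(1,2) show "\<exists>V. open V \<and> z \<in> V \<and> smooth_on V (\<lambda>z. \<tau> (\<Phi> z) (frechet_derivative \<Phi> (at z) a))"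
    by (intro exI[of _ V]) simp
qed

lemma linear_pullback:
  fixes \<Phi> :: "'e::euclidean_space \<Rightarrow> 'a::euclidean_space"
  assumes "one_form M \<tau>" and \<Phi>: "smooth_on UNIV \<Phi>" "range \<Phi> \<subseteq> M"
  shows "linear (\<lambda>a. \<tau> (\<Phi> z) (frechet_derivative \<Phi> (at z) a))"
proof -
  obtain U \<tau>' V where U: "smooth_1form_on U \<tau>'" "d1_on M \<tau> (\<Phi> z) = d1 \<tau>' (\<Phi> z)"
    and V: "open V" "z \<in> V" "\<Phi> ` V \<subseteq> U"
    and eq: "\<And>x a. x \<in> V \<Longrightarrow> \<tau>' (\<Phi> x) (frechet_derivative \<Phi> (at x) a) = \<tau> (\<Phi> x) (frechet_derivative \<Phi> (at x) a)"
    using pullback_local[OF assms, of z] by metis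
  have "linear (\<tau>' (\<Phi> z))" using U(1) V by (auto simp: smooth_1form_on_def)
  then have "linear (\<tau>' (\<Phi> z) \<circ> frechet_derivative \<Phi> (at z))"
    using has_derivative_linear[OF smooth_on_has_derivative[OF \<Phi>(1)]] linear_compose by blast
  then show ?thesis by (simp add: o_def eq[OF V(2)])
qed

text \<open>Differentiating the pulled-back form leaves, besides the terms of
  \<open>d1 \<tau>'\<close>, second derivatives of \<Phi>, which are symmetric and cancel. The
  right-hand side is free of the extension chosen in \<open>d1_on\<close>; this is how that choice
  is eliminated.\<close>

lemma d1_on_pullback:
  fixes \<Phi> :: "'e::euclidean_space \<Rightarrow> 'a::euclidean_space"
  assumes "one_form M \<tau>" and \<Phi>: "smooth_on UNIV \<Phi>" "range \<Phi> \<subseteq> M"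
  shows "d1_on M \<tau> (\<Phi> z) (frechet_derivative \<Phi> (at z) a) (frechet_derivative \<Phi> (at z) b) =
    d1 (\<lambda>z a. \<tau> (\<Phi> z) (frechet_derivative \<Phi> (at z) a)) z a b"
proof -
  obtain U \<tau>' V where U: "smooth_1form_on U \<tau>'" and d: "d1_on M \<tau> (\<Phi> z) = d1 \<tau>' (\<Phi> z)"
    and V: "open V" "z \<in> V" "\<Phi> ` V \<subseteq> U"
    and eq: "\<And>x a. x \<in> V \<Longrightarrow> \<tau>' (\<Phi> x) (frechet_derivative \<Phi> (at x) a) = \<tau> (\<Phi> x) (frechet_derivative \<Phi> (at x) a)"
    using pullback_local[OF assms, of z] by metis
  have zU: "\<Phi> z \<in> U" using V by blast
  define w where "w a x = frechet_derivative \<Phi> (at x) a" for a x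
  have \<Phi>': "(\<Phi> has_derivative (\<lambda>h. w h z)) (at z)"
    using smooth_on_has_derivative[OF \<Phi>(1)] by (simp add: w_def)
  have w': "(w a has_derivative frechet_derivative (w a) (at z)) (at z)" for a
    by (rule smooth_on_has_derivative[of UNIV])
       (simp_all add: w_def[abs_def] smooth_on_frechet_derivative[OF \<Phi>(1)])
  have sym: "frechet_derivative (w a) (at z) b = frechet_derivative (w b) (at z) a" for a b
    unfolding w_def[abs_def] by (rule frechet_derivative_commute[OF \<Phi>(1)])
  have D: "frechet_derivative (\<lambda>x. \<tau> (\<Phi> x) (w a x)) (at z) h =
      frechet_derivative (\<lambda>q. \<tau>' q (w a z)) (at (\<Phi> z)) (w h z) +
      \<tau>' (\<Phi> z) (frechet_derivative (w a) (at z) h)" for a h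
  proof -
    have "((\<lambda>x. \<tau> (\<Phi> x) (w a x)) has_derivative
      (\<lambda>h. frechet_derivative (\<lambda>q. \<tau>' q (w a z)) (at (\<Phi> z)) (w h z) +
      \<tau>' (\<Phi> z) (frechet_derivative (w a) (at z) h))) (at z)"
      by (rule has_derivative_transform_within_open[OF
            smooth_1form_on_has_derivative[OF U zU \<Phi>' w'] V(1,2)])
         (simp add: eq w_def)
    from frechet_derivative_at[OF this] show ?thesis by (simp add: fun_eq_iff)
  qed
  show ?thesis
    unfolding d
    using D[of a b] D[of b a] sym[of a b]
    by (simp add: d1_def w_def)
qed

text \<open>Otherwise both \<tau> and its exterior derivative would factor through the quotient of
  the tangent space by \<open>v1\<close>, which has dimension at most two, and their wedge product
  would vanish at \<open>p\<close>.\<close>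

lemma contact_form_nonzero_on_kernel:
  assumes "contact_form M \<tau>" "p \<in> M"
    and tan: "v1 \<in> tangent_space M p" "v2 \<in> tangent_space M p" "v3 \<in> tangent_space M p"
    and span: "\<And>\<xi>. \<xi> \<in> tangent_space M p \<Longrightarrow> \<exists>a b c. \<xi> = a *\<^sub>R v1 + b *\<^sub>R v2 + c *\<^sub>R v3"
    and ker: "d1_on M \<tau> p v1 v2 = 0" "d1_on M \<tau> p v1 v3 = 0"
  shows "\<tau> p v1 \<noteq> 0"
proof
  assume 0: "\<tau> p v1 = 0"
  have of: "one_form M \<tau>" using assms(1) by (simp add: contact_form_def)
  obtain U \<tau>' where U: "smooth_1form_on U \<tau>'" "p \<in> U" and d: "d1_on M \<tau> p = d1 \<tau>' p"
    and ext: "\<And>q \<xi>. q \<in> U \<inter> M \<Longrightarrow> \<xi> \<in> tangent_space M q \<Longrightarrow> \<tau> q \<xi> = \<tau>' q \<xi>"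
    using one_form_extension[OF of assms(2)] by blast
  obtain \<xi> \<eta> \<zeta> where t: "\<xi> \<in> tangent_space M p" "\<eta> \<in> tangent_space M p" "\<zeta> \<in> tangent_space M p"
    and nz: "\<tau> p \<xi> * d1_on M \<tau> p \<eta> \<zeta> + \<tau> p \<eta> * d1_on M \<tau> p \<zeta> \<xi> + \<tau> p \<zeta> * d1_on M \<tau> p \<xi> \<eta> \<noteq> 0"
    using assms(1,2) unfolding contact_form_def by blast
  have lin: "linear (\<tau>' p)" using U by (simp add: smooth_1form_on_def)
  have \<tau>: "\<tau> p (a *\<^sub>R v1 + b *\<^sub>R v2 + c *\<^sub>R v3) = b * \<tau> p v2 + c * \<tau> p v3"
    if "a *\<^sub>R v1 + b *\<^sub>R v2 + c *\<^sub>R v3 \<in> tangent_space M p" for a b c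
    using that tan 0 U(2) assms(2) by (simp add: ext linear_add[OF lin] linear_cmul[OF lin])
  note bil = bilinear_d1[OF U]
  have skew: "d1 \<tau>' p v2 v1 = 0" "d1 \<tau>' p v3 v1 = 0" "d1 \<tau>' p v3 v2 = - d1 \<tau>' p v2 v3"
    "d1 \<tau>' p v v = 0" for v
    using ker d1_skew[of \<tau>' p v2 v1] d1_skew[of \<tau>' p v3 v1] d1_skew[of \<tau>' p v3 v2]
    by (simp_all add: d) (simp add: d1_def)
  \<comment> \<open>Modulo \<open>v1\<close> the 2-form is a multiple of the determinant. With the
    fact \<open>\<tau>\<close> the wedge product becomes a 3x3 determinant with linearly dependent
    columns.\<close>
  have D: "d1_on M \<tau> p (a *\<^sub>R v1 + b *\<^sub>R v2 + c *\<^sub>R v3) (a' *\<^sub>R v1 + b' *\<^sub>R v2 + c' *\<^sub>R v3)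
      = (b * c' - c * b') * d1 \<tau>' p v2 v3" for a b c a' b' c'
    using ker unfolding d
    by (simp add: bilinear_ladd[OF bil] bilinear_radd[OF bil] bilinear_lmul[OF bil]
        bilinear_rmul[OF bil] skew algebra_simps)
  obtain a1 b1 c1 a2 b2 c2 a3 b3 c3 where
    e: "\<xi> = a1 *\<^sub>R v1 + b1 *\<^sub>R v2 + c1 *\<^sub>R v3" "\<eta> = a2 *\<^sub>R v1 + b2 *\<^sub>R v2 + c2 *\<^sub>R v3"
      "\<zeta> = a3 *\<^sub>R v1 + b3 *\<^sub>R v2 + c3 *\<^sub>R v3"
    using span[OF t(1)] span[OF t(2)] span[OF t(3)] by blast
  show False
    using nz \<tau>[OF t(1)[unfolded e]] \<tau>[OF t(2)[unfolded e]] \<tau>[OF t(3)[unfolded e]]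
    unfolding e D by (simp add: algebra_simps)
qed

text \<open>Stokes' theorem on the cylinder \<open>(s, t) \<mapsto> p + s a + t b\<close>, differentiated in \<open>s\<close>.\<close>

lemma cylinder_integral_derivative:
  fixes \<beta> :: "'e::euclidean_space \<Rightarrow> 'e \<Rightarrow> real" and l u :: real
  assumes sm: "\<And>v. smooth_on UNIV (\<lambda>z. \<beta> z v)" and "l \<le> u"
    and per: "\<And>s. \<beta> (p + s *\<^sub>R a + u *\<^sub>R b) a = \<beta> (p + s *\<^sub>R a + l *\<^sub>R b) a"
  shows "((\<lambda>s. integral {l..u} (\<lambda>t. \<beta> (p + s *\<^sub>R a + t *\<^sub>R b) b)) has_real_derivative
    integral {l..u} (\<lambda>t. d1 \<beta> (p + s *\<^sub>R a + t *\<^sub>R b) a b)) (at s)"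
proof -
  let ?q = "\<lambda>s t. (p + s *\<^sub>R a) + t *\<^sub>R b"
  define Db where "Db z = frechet_derivative (\<lambda>z. \<beta> z b) (at z) a" for z
  define Da where "Da z = frechet_derivative (\<lambda>z. \<beta> z a) (at z) b" for z
  have cont: "continuous_on UNIV (\<lambda>z. \<beta> z b)" "continuous_on UNIV Db"
    unfolding Db_def[abs_def] using sm
    by (auto intro!: smooth_on_imp_continuous_on smooth_on_frechet_derivative)
  have swap: "?q s t = (p + t *\<^sub>R b) + s *\<^sub>R a" for s t by simp
  have "((\<lambda>s. integral (cbox l u) (\<lambda>t. \<beta> (?q s t) b)) has_vector_derivative
      integral (cbox l u) (\<lambda>t. Db (?q s t))) (at s within UNIV)"
  proof (rule leibniz_rule_vector_derivative)
    fix s t :: real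
    show "((\<lambda>s. \<beta> (?q s t) b) has_vector_derivative Db (?q s t)) (at s within UNIV)"
      unfolding swap Db_def by (rule smooth_on_has_vector_derivative[OF sm])
    show "(\<lambda>t. \<beta> (?q s t) b) integrable_on cbox l u"
      by (intro integrable_continuous continuous_on_compose2[OF cont(1)] continuous_intros) auto
  next
    show "continuous_on (UNIV \<times> cbox l u) (\<lambda>(s, t). Db (?q s t))"
      unfolding split_beta
      by (intro continuous_on_compose2[OF cont(2)] continuous_intros) auto
  qed auto
  \<comment> \<open>\<open>Da\<close> is a total derivative in \<open>t\<close>; by
    \<open>per\<close> its boundary values agree, so it contributes nothing to the integral of
    \<open>d1\<close>.\<close>
  moreover have "((\<lambda>t. Da (?q s t)) has_integral 0) {l..u}"
    using fundamental_theorem_of_calculus[OF \<open>l \<le> u\<close>, of "\<lambda>t. \<beta> (?q s t) a" "\<lambda>t. Da (?q s t)"]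
      smooth_on_has_vector_derivative[OF sm[of a], of "p + s *\<^sub>R a" b] per[of s]
    by (simp add: Da_def)
  moreover have "(\<lambda>t. Db (?q s t)) integrable_on {l..u}"
    by (intro integrable_continuous_interval continuous_on_compose2[OF cont(2)] continuous_intros) auto
  ultimately have "integral {l..u} (\<lambda>t. Db (?q s t)) = integral {l..u} (\<lambda>t. d1 \<beta> (?q s t) a b)"
    unfolding d1_def Da_def[symmetric] Db_def[symmetric]
    by (subst integral_diff) (auto dest: integral_unique)
  with \<open>((\<lambda>s. integral (cbox l u) (\<lambda>t. \<beta> (?q s t) b)) has_vector_derivative _) _\<close>
  show ?thesis
    by (simp add: has_real_derivative_iff_has_vector_derivative)
qed

section \<open>The sphere and the magnetic form\<close>

lemma smooth_on_Pair:
  fixes f :: "'a::real_normed_vector \<Rightarrow> 'b::euclidean_space" and g :: "'a \<Rightarrow> 'c::euclidean_space"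
  assumes "open U" "smooth_on U f" "smooth_on U g"
  shows "smooth_on U (\<lambda>x. (f x, g x))"
proof -
  have "smooth_on U (\<lambda>x. (f x, 0 :: 'c))" "smooth_on U (\<lambda>x. (0 :: 'b, g x))"
    using smooth_on_compose[OF assms(1) open_UNIV subset_UNIV assms(2) smooth_on_bounded_linear[of "\<lambda>x. (x, 0)"]]
      smooth_on_compose[OF assms(1) open_UNIV subset_UNIV assms(3) smooth_on_bounded_linear[of "\<lambda>x. (0, x)"]]
    by (simp_all add: bounded_linear_Pair bounded_linear_ident bounded_linear_zero)
  from smooth_on_add[OF assms(1) this] show ?thesis by simp
qed

section \<open>Tangent vectors of level sets and of the sphere\<close>

lemma tangent_space_derivative_zero:
  fixes F :: "'a::euclidean_space \<Rightarrow> real"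
  assumes "\<xi> \<in> tangent_space M p" "(F has_derivative F') (at p)" "\<And>q. q \<in> M \<Longrightarrow> F q = c"
  shows "F' \<xi> = 0"
proof -
  obtain \<gamma> \<epsilon> where \<gamma>: "\<epsilon> > (0::real)" "\<And>t. t \<in> {-\<epsilon><..<\<epsilon>} \<Longrightarrow> \<gamma> t \<in> M" "\<gamma> 0 = p"
    "(\<gamma> has_vector_derivative \<xi>) (at 0)"
    using assms(1) unfolding tangent_space_def by blast
  have "((\<lambda>t. F (\<gamma> t)) has_derivative (\<lambda>h. F' (h *\<^sub>R \<xi>))) (at 0)"
    using has_derivative_compose[OF \<gamma>(4)[unfolded has_vector_derivative_def]] assms(2) \<gamma>(3) by blast
  moreover have "((\<lambda>t. F (\<gamma> t)) has_derivative (\<lambda>h. 0)) (at 0)"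
    by (rule has_derivative_transform_within_open[OF has_derivative_const[of c], of "{-\<epsilon><..<\<epsilon>}"])
       (use \<gamma>(1,2) assms(3) in auto)
  ultimately have "(\<lambda>h. F' (h *\<^sub>R \<xi>)) = (\<lambda>h. 0)"
    by (rule has_derivative_unique)
  from fun_cong[OF this, of 1] show ?thesis by simp
qed

lemma tangent_space_S2:
  assumes "p \<in> S2"
  shows "tangent_space S2 p = {\<xi>. p \<bullet> \<xi> = 0}"
proof (intro set_eqI iffI CollectI)
  fix \<xi> assume \<xi>: "\<xi> \<in> tangent_space S2 p"
  have "((\<lambda>q. q \<bullet> q) has_derivative (\<lambda>h. p \<bullet> h + h \<bullet> p)) (at p)"
    by (auto intro!: derivative_eq_intros)
  from tangent_space_derivative_zero[OF \<xi> this, of 1] show "p \<bullet> \<xi> = 0"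
    by (simp add: inner_commute dot_square_norm)
next
  fix \<xi> assume "\<xi> \<in> {\<xi>. p \<bullet> \<xi> = 0}"
  then have \<xi>: "p \<bullet> \<xi> = 0" by simp
  \<comment> \<open>The great circle with initial velocity \<xi>. For \<open>\<xi> = 0\<close> the
    quotient is 0 and the curve rests at \<open>p\<close>.\<close>
  define \<gamma> where "\<gamma> t = cos (t * norm \<xi>) *\<^sub>R p + (sin (t * norm \<xi>) / norm \<xi>) *\<^sub>R \<xi>" for t :: real
  have lin: "smooth_on UNIV (\<lambda>t::real. t * norm \<xi>)"
    by (intro smooth_on_bounded_linear bounded_linear_mult_left) simp
  have "smooth_on UNIV \<gamma>"
    unfolding \<gamma>_def[abs_def] divide_inverse
    by (intro smooth_on_add smooth_on_scaleR smooth_on_mult smooth_on_cos smooth_on_sin smooth_on_const lin open_UNIV)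
  then have sm: "smooth_on {-1<..<1} \<gamma>" using smooth_on_subset by blast
  have n: "norm (\<gamma> t) = 1" for t
  proof -
    have "p \<bullet> p = 1" using assms by (simp add: dot_square_norm)
    then have "\<gamma> t \<bullet> \<gamma> t = (cos (t * norm \<xi>))\<^sup>2 + (sin (t * norm \<xi>) / norm \<xi>)\<^sup>2 * (\<xi> \<bullet> \<xi>)"
      by (simp add: \<gamma>_def inner_add_left inner_add_right inner_commute[of \<xi> p] \<xi> power2_eq_square)
    also have "\<dots> = 1"
      by (cases "\<xi> = 0") (simp_all add: dot_square_norm power_divide)
    finally show ?thesis by (simp add: norm_eq_1)
  qed
  have "(\<gamma> has_vector_derivative \<xi>) (at 0)"
    unfolding \<gamma>_def[abs_def] has_vector_derivative_def
    by (cases "\<xi> = 0") (auto intro!: derivative_eq_intros simp: fun_eq_iff)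
  then show "\<xi> \<in> tangent_space S2 p"
    unfolding tangent_space_def using sm n
    by (intro CollectI exI[of _ \<gamma>] exI[of _ 1]) (simp add: \<gamma>_def)
qed

lemma TS2_eq: "TS2 = {(x, v). norm x = 1 \<and> x \<bullet> v = 0}"
  by (auto simp: tangent_bundle_def tangent_space_S2)

text \<open>The remainder after projection is orthogonal to \<open>p\<close>, \<xi> and
  \<open>cross3 p \<xi>\<close>. By Lagrange's identity its cross product with
  \<open>cross3 p \<xi>\<close> vanishes too, so it is both parallel and orthogonal to a nonzero
  vector.\<close>

lemma tangent_plane_frame:
  fixes p \<xi> \<eta> :: "real^3"
  assumes "norm p = 1" "p \<bullet> \<xi> = 0" "p \<bullet> \<eta> = 0" "\<xi> \<noteq> 0"
  obtains a b where "\<eta> = a *\<^sub>R \<xi> + b *\<^sub>R cross3 p \<xi>"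
proof -
  let ?n = "cross3 p \<xi>"
  have n: "norm ?n = norm \<xi>"
    using norm_cross_dot[of p \<xi>] assms by simp
  then have pos: "\<xi> \<bullet> \<xi> \<noteq> 0" "?n \<bullet> ?n \<noteq> 0" using assms(4) by (auto simp: dot_square_norm)
  define a b where "a = (\<eta> \<bullet> \<xi>) / (\<xi> \<bullet> \<xi>)" and "b = (\<eta> \<bullet> ?n) / (?n \<bullet> ?n)"
  define v where "v = \<eta> - a *\<^sub>R \<xi> - b *\<^sub>R ?n"
  have "v \<bullet> \<xi> = 0" "v \<bullet> ?n = 0" "v \<bullet> p = 0"
    using pos assms
    by (simp_all add: v_def a_def b_def inner_diff_left inner_diff_right dot_cross_self
        inner_commute[of _ p] inner_commute[of ?n \<xi>])
  then have "cross3 v ?n = 0" "v \<bullet> ?n = 0"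
    by (simp_all add: Lagrange)
  then have "norm v * norm ?n = 0"
    using norm_cross_dot[of v ?n] by simp
  then have "v = 0" using n assms(4) by simp
  then show thesis using that[of a b] by (simp add: v_def algebra_simps)
qed

text \<open>An alternating 3-form vanishes on a plane. The extension is arbitrary because
  \<open>d2_on\<close> picks one by \<open>SOME\<close>; bilinearity and skewness pass from
  \<open>\<omega>'\<close> near \<open>p\<close> to its derivatives.\<close>

lemma extends_2form_d2_tangent:
  fixes \<omega>' :: "real^3 \<Rightarrow> real^3 \<Rightarrow> real^3 \<Rightarrow> real"
  assumes ext: "extends_2form S2 p \<omega> \<omega>'" and p: "norm p = 1"
    and tan: "p \<bullet> \<xi> = 0" "p \<bullet> \<eta> = 0" "p \<bullet> \<zeta> = 0"
  shows "d2 \<omega>' p \<xi> \<eta> \<zeta> = 0"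
proof -
  obtain U where U: "open U" "p \<in> U" and bil: "\<And>q. q \<in> U \<Longrightarrow> bilinear (\<omega>' q)"
    and sm: "\<And>v w. smooth_on U (\<lambda>q. \<omega>' q v w)" and alt: "\<And>q v. \<omega>' q v v = 0"
    using ext unfolding extends_2form_def extends_bilinear_def by auto
  define D where "D v w = frechet_derivative (\<lambda>q. \<omega>' q v w) (at p)" for v w
  have D: "((\<lambda>q. \<omega>' q v w) has_derivative D v w) (at p)" for v w
    unfolding D_def by (rule smooth_on_has_derivative[OF sm U(2)])
  have eqI: "D v w = F" if "(f has_derivative F) (at p)" "\<And>q. q \<in> U \<Longrightarrow> f q = \<omega>' q v w" for v w f F
    using has_derivative_unique[OF has_derivative_transform_within_open[OF that(1) U that(2)] D] by simp
  have add1: "D (v + v') w h = D v w h + D v' w h" for v v' w h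
    by (rule fun_cong[OF eqI[OF has_derivative_add[OF D D]]]) (simp add: bilinear_ladd[OF bil])
  have mul1: "D (c *\<^sub>R v) w h = c * D v w h" for v c w h
    by (rule fun_cong[OF eqI[OF has_derivative_mult_right[OF D]]]) (simp add: bilinear_lmul[OF bil])
  have add2: "D w (v + v') h = D w v h + D w v' h" for v v' w h
    by (rule fun_cong[OF eqI[OF has_derivative_add[OF D D]]]) (simp add: bilinear_radd[OF bil])
  have mul2: "D w (c *\<^sub>R v) h = c * D w v h" for v c w h
    by (rule fun_cong[OF eqI[OF has_derivative_mult_right[OF D]]]) (simp add: bilinear_rmul[OF bil])
  have lin: "linear (D v w)" for v w by (rule has_derivative_linear[OF D])
  have D0: "D v v h = 0" for v h
    by (rule fun_cong[OF eqI[OF has_derivative_const]]) (simp add: alt)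
  have skew: "D w v h = - D v w h" for v w h
    using D0[of "v + w" h] D0[of v h] D0[of w h] unfolding add1 add2 by linarith
  show ?thesis
  proof (cases "\<xi> = 0")
    case True
    have "D 0 w h = 0" "D w 0 h = 0" for w h
      using mul1[of 0 0 w h] mul2[of w 0 0 h] by simp_all
    then show ?thesis using linear_0[OF lin] by (simp add: d2_def D_def[symmetric] True)
  next
    case False
    obtain a b where e: "\<eta> = a *\<^sub>R \<xi> + b *\<^sub>R cross3 p \<xi>"
      using tangent_plane_frame[OF p tan(1,2) False] .
    obtain a' b' where z: "\<zeta> = a' *\<^sub>R \<xi> + b' *\<^sub>R cross3 p \<xi>"
      using tangent_plane_frame[OF p tan(1,3) False] .
    show ?thesis
      unfolding d2_def D_def[symmetric] e z
      by (simp add: add1 add2 mul1 mul2 linear_add[OF lin] linear_cmul[OF lin] D0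
          skew[of \<xi> "cross3 p \<xi>"] algebra_simps)
  qed
qed

text \<open>
  With \<open>f(z) = e + m z\<^sup>2 (1 + z)\<close>, eliminating \<open>u\<close> from the two conditions on the latitude \<open>cos s = 1/5\<close> gives
  \<open>e : m = 31 : 9375\<close>, and then \<open>u = 2405 sin s\<close>.
\<close>

definition magnetic_density :: "real \<Rightarrow> real" where
  "magnetic_density z = 31 + 9375 * (z * z * (1 + z))"

text \<open>On the unit sphere \<open>p \<bullet> cross3 v w\<close> is the area form. The formula
  is polynomial and alternating on the whole space, so it serves as its own extension.\<close>

definition magnetic_form :: "real^3 \<Rightarrow> real^3 \<Rightarrow> real^3 \<Rightarrow> real" where
  "magnetic_form p v w = magnetic_density (p $ 3) * (p \<bullet> cross3 v w)"

lemma symplectic_magnetic_form: "symplectic_form S2 magnetic_form"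
  unfolding symplectic_form_def
proof (intro conjI ballI impI)
  have "bilinear (magnetic_form q)" for q
    unfolding bilinear_def magnetic_form_def
    by (intro conjI allI linearI)
       (simp_all add: cross_add_left cross_add_right cross_mult_left cross_mult_right inner_add_right algebra_simps)
  moreover have "smooth_on UNIV (\<lambda>q. magnetic_form q v w)" for v w
    unfolding magnetic_form_def magnetic_density_def
    by (intro smooth_on_mult smooth_on_add smooth_on_const open_UNIV smooth_on_bounded_linear
        bounded_linear_vec_nth bounded_linear_inner_left)
  moreover have "magnetic_form q v v = 0" for q v by (simp add: magnetic_form_def)
  ultimately have ext: "extends_2form S2 p magnetic_form magnetic_form" for p
    unfolding extends_2form_def extends_bilinear_def by (intro conjI exI[of _ UNIV]) simp_all
  then show "two_form S2 magnetic_form" unfolding two_form_def by blast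
  fix p :: R3 assume p: "p \<in> S2"
  {
    fix \<xi> \<eta> \<zeta>
    assume "\<xi> \<in> tangent_space S2 p" "\<eta> \<in> tangent_space S2 p" "\<zeta> \<in> tangent_space S2 p"
    moreover have "extends_2form S2 p magnetic_form (SOME \<omega>'. extends_2form S2 p magnetic_form \<omega>')"
      by (rule someI[of "extends_2form S2 p magnetic_form", OF ext])
    ultimately show "d2_on S2 magnetic_form p \<xi> \<eta> \<zeta> = 0"
      unfolding d2_on_def using extends_2form_d2_tangent p by (simp add: tangent_space_S2[OF p])
  next
    fix \<xi> assume "\<xi> \<in> tangent_space S2 p"
      and nd: "\<forall>\<eta>\<in>tangent_space S2 p. magnetic_form p \<xi> \<eta> = 0"
    then have \<xi>: "p \<bullet> \<xi> = 0" by (simp add: tangent_space_S2[OF p])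
    \<comment> \<open>\<open>cross3 p \<xi>\<close> is \<xi> after a quarter turn, so its area
      pairing with \<xi> is \<open>\<xi> \<bullet> \<xi>\<close>.\<close>
    have "magnetic_form p \<xi> (cross3 p \<xi>) = 0"
      using nd by (simp add: tangent_space_S2[OF p] dot_cross_self)
    moreover have "p \<bullet> cross3 \<xi> (cross3 p \<xi>) = \<xi> \<bullet> \<xi>"
      using p \<xi> by (simp add: Lagrange inner_diff_right inner_commute dot_square_norm)
    moreover have "magnetic_density (p $ 3) > 0"
    proof -
      have "\<bar>p $ 3\<bar> \<le> 1" using component_le_norm_cart[of p 3] p by simp
      then have "0 \<le> p $ 3 * p $ 3 * (1 + p $ 3)" by (intro mult_nonneg_nonneg[OF zero_le_square]) auto
      then show ?thesis by (simp add: magnetic_density_def)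
    qed
    ultimately show "\<xi> = 0" by (simp add: magnetic_form_def)
  }
qed

lemma riemannian_metric_inner: "riemannian_metric M (\<lambda>_. (\<bullet>))"
proof -
  have "bilinear ((\<bullet>) :: 'a \<Rightarrow> 'a \<Rightarrow> real)"
    by (simp add: bilinear_conv_bounded_bilinear bounded_bilinear_inner)
  then have "extends_bilinear M p (\<lambda>_. (\<bullet>)) (\<lambda>_. (\<bullet>))" for p
    unfolding extends_bilinear_def by (intro exI[of _ UNIV]) (simp add: smooth_on_const)
  then show ?thesis
    unfolding riemannian_metric_def by (auto simp: inner_commute)
qed

section \<open>Euler angles on the energy level\<close>

text \<open>\<open>radial\<close>, \<open>east\<close> and the third axis form the cylindrical
  frame; \<open>sphere_point\<close>, \<open>south\<close> and \<open>east\<close> form the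
  spherical one, oriented so that south times east is the outward normal.\<close>

definition radial :: "real \<Rightarrow> real^3" where
  "radial \<theta> = cos \<theta> *\<^sub>R axis 1 1 + sin \<theta> *\<^sub>R axis 2 1"

definition east :: "real \<Rightarrow> real^3" where
  "east \<theta> = (- sin \<theta>) *\<^sub>R axis 1 1 + cos \<theta> *\<^sub>R axis 2 1"

definition sphere_point :: "real \<Rightarrow> real \<Rightarrow> real^3" where
  "sphere_point s \<theta> = sin s *\<^sub>R radial \<theta> + cos s *\<^sub>R axis 3 1"

definition south :: "real \<Rightarrow> real \<Rightarrow> real^3" where
  "south s \<theta> = cos s *\<^sub>R radial \<theta> - sin s *\<^sub>R axis 3 1"

lemmas frame_defs = radial_def east_def sphere_point_def south_def

lemma frame_inner:
  "radial \<theta> \<bullet> radial \<theta> = 1" "east \<theta> \<bullet> east \<theta> = 1" "radial \<theta> \<bullet> east \<theta> = 0"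
  "radial \<theta> \<bullet> axis 3 1 = 0" "axis 3 1 \<bullet> radial \<theta> = 0" "east \<theta> \<bullet> axis 3 1 = 0" "axis 3 1 \<bullet> east \<theta> = 0"
  "east \<theta> \<bullet> radial \<theta> = 0"
  by (simp_all add: radial_def east_def inner_add_left inner_add_right inner_diff_left inner_diff_right inner_axis_axis
      power2_eq_square[symmetric])

lemma frame_orthonormal:
  "sphere_point s \<theta> \<bullet> sphere_point s \<theta> = 1" "south s \<theta> \<bullet> south s \<theta> = 1"
  "sphere_point s \<theta> \<bullet> south s \<theta> = 0" "south s \<theta> \<bullet> sphere_point s \<theta> = 0"
  "sphere_point s \<theta> \<bullet> east \<theta> = 0" "east \<theta> \<bullet> sphere_point s \<theta> = 0"
  "south s \<theta> \<bullet> east \<theta> = 0" "east \<theta> \<bullet> south s \<theta> = 0"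
  by (simp_all add: sphere_point_def south_def inner_add_left inner_add_right inner_diff_left
      inner_diff_right frame_inner inner_axis_axis power2_eq_square[symmetric])

lemma sphere_point_3: "sphere_point s \<theta> $ 3 = cos s"
  by (simp add: sphere_point_def radial_def axis_def)

lemma cross_south_east: "cross3 (south s \<theta>) (east \<theta>) = sphere_point s \<theta>"
proof -
  have "cross3 (radial \<theta>) (east \<theta>) = axis 3 1" "cross3 (axis 3 1) (east \<theta>) = - radial \<theta>"
    by (simp_all add: radial_def east_def vec_eq_iff forall_3 cross3_def axis_def
        power2_eq_square[symmetric])
  then show ?thesis
    by (simp add: south_def sphere_point_def Cross3.left_diff_distrib cross_mult_left)
qed

text \<open>As in \<open>tangent_plane_frame\<close>: the remainder is orthogonal to the frame, and
  because \<open>sphere_point\<close> is the cross product of the other two vectors, it is also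
  parallel to \<open>sphere_point\<close>.\<close>

lemma frame_expand:
  "w = (w \<bullet> sphere_point s \<theta>) *\<^sub>R sphere_point s \<theta> + (w \<bullet> south s \<theta>) *\<^sub>R south s \<theta> + (w \<bullet> east \<theta>) *\<^sub>R east \<theta>"
proof -
  define v where "v = w - (w \<bullet> sphere_point s \<theta>) *\<^sub>R sphere_point s \<theta> -
    (w \<bullet> south s \<theta>) *\<^sub>R south s \<theta> - (w \<bullet> east \<theta>) *\<^sub>R east \<theta>"
  have v: "v \<bullet> sphere_point s \<theta> = 0" "v \<bullet> south s \<theta> = 0" "v \<bullet> east \<theta> = 0"
    by (simp_all add: v_def inner_diff_left frame_orthonormal frame_inner(2))
  have "cross3 v (sphere_point s \<theta>) = 0"
    unfolding cross_south_east[symmetric] Lagrange by (simp add: v)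
  then have "norm v * norm (sphere_point s \<theta>) = 0"
    using norm_cross_dot[of v "sphere_point s \<theta>"] v(1) by simp
  moreover have "norm (sphere_point s \<theta>) = 1" by (simp add: norm_eq_1 frame_orthonormal)
  ultimately have "v = 0" by simp
  then show ?thesis by (simp add: v_def algebra_simps)
qed

lemma has_derivative_radial [derivative_intros]:
  assumes "(h has_derivative h') (at z)"
  shows "((\<lambda>z. radial (h z)) has_derivative (\<lambda>v. h' v *\<^sub>R east (h z))) (at z)"
  unfolding radial_def east_def using assms
  by (auto intro!: derivative_eq_intros simp: algebra_simps)

lemma has_derivative_east [derivative_intros]:
  assumes "(h has_derivative h') (at z)"
  shows "((\<lambda>z. east (h z)) has_derivative (\<lambda>v. - h' v *\<^sub>R radial (h z))) (at z)"
  unfolding radial_def east_def using assms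
  by (auto intro!: derivative_eq_intros simp: algebra_simps)

lemma has_derivative_sphere_point:
  assumes "(h has_derivative h') (at z)" "(k has_derivative k') (at z)"
  shows "((\<lambda>z. sphere_point (h z) (k z)) has_derivative
    (\<lambda>v. h' v *\<^sub>R south (h z) (k z) + (k' v * sin (h z)) *\<^sub>R east (k z))) (at z)"
  unfolding sphere_point_def south_def using assms
  by (auto intro!: derivative_eq_intros simp: algebra_simps)

lemma has_derivative_south:
  assumes "(h has_derivative h') (at z)" "(k has_derivative k') (at z)"
  shows "((\<lambda>z. south (h z) (k z)) has_derivative
    (\<lambda>v. - h' v *\<^sub>R sphere_point (h z) (k z) + (k' v * cos (h z)) *\<^sub>R east (k z))) (at z)"
  unfolding sphere_point_def south_def using assms
  by (auto intro!: derivative_eq_intros simp: algebra_simps)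

text \<open>
  Colatitude \<open>s\<close>, longitude \<open>\<theta>\<close>, and the angle \<open>\<psi>\<close> from the eastward direction to the velocity, turning south.
  The map stays smooth over the poles, where it is no longer an immersion.
\<close>

definition level_chart :: "real \<Rightarrow> real \<times> real \<times> real \<Rightarrow> (real^3) \<times> (real^3)" where
  "level_chart u = (\<lambda>(s, \<theta>, \<psi>).
     (sphere_point s \<theta>, u *\<^sub>R (cos \<psi> *\<^sub>R east \<theta> + sin \<psi> *\<^sub>R south s \<theta>)))"

lemma smooth_level_chart: "smooth_on UNIV (level_chart u)"
proof -
  have p: "smooth_on UNIV (\<lambda>z::real \<times> real \<times> real. fst z)"
    "smooth_on UNIV (\<lambda>z::real \<times> real \<times> real. fst (snd z))"
    "smooth_on UNIV (\<lambda>z::real \<times> real \<times> real. snd (snd z))"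
    by (intro smooth_on_bounded_linear open_UNIV bounded_linear_fst bounded_linear_snd
        bounded_linear_compose[OF bounded_linear_fst] bounded_linear_compose[OF bounded_linear_snd])+
  \<comment> \<open>Negative coefficients become products with -1, to match the closure rules for
    sums and products.\<close>
  have minus: "east \<theta> = (- 1 * sin \<theta>) *\<^sub>R axis 1 1 + cos \<theta> *\<^sub>R axis 2 1"
    "south s \<theta> = cos s *\<^sub>R radial \<theta> + (- 1 * sin s) *\<^sub>R axis 3 1" for s \<theta>
    by (simp_all add: east_def south_def)
  show ?thesis
    unfolding level_chart_def split_beta minus radial_def sphere_point_def
    by (intro smooth_on_Pair smooth_on_add smooth_on_scaleR smooth_on_mult smooth_on_sin smooth_on_cos
        smooth_on_const p open_UNIV)
qed

text \<open>The differential of \<open>level_chart\<close> in the frame \<open>south\<close>,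
  \<open>east\<close>, \<open>sphere_point\<close>. Differentiating \<open>east\<close> produces
  \<open>radial\<close>, which \<open>radial_frame\<close> resolves.\<close>

definition level_chart_deriv ::
  "real \<Rightarrow> real \<times> real \<times> real \<Rightarrow> real \<times> real \<times> real \<Rightarrow> (real^3) \<times> (real^3)" where
  "level_chart_deriv u = (\<lambda>(s, \<theta>, \<psi>) (a, b, c).
     (a *\<^sub>R south s \<theta> + (b * sin s) *\<^sub>R east \<theta>,
      u *\<^sub>R ((c * cos \<psi> - b * cos \<psi> * cos s) *\<^sub>R south s \<theta> + (b * sin \<psi> * cos s - c * sin \<psi>) *\<^sub>R east \<theta>
        - (a * sin \<psi> + b * cos \<psi> * sin s) *\<^sub>R sphere_point s \<theta>)))"

lemma radial_frame: "radial \<theta> = sin s *\<^sub>R sphere_point s \<theta> + cos s *\<^sub>R south s \<theta>"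
proof -
  have "sin s *\<^sub>R sphere_point s \<theta> + cos s *\<^sub>R south s \<theta> =
      (sin s * sin s) *\<^sub>R radial \<theta> + (cos s * cos s) *\<^sub>R radial \<theta>"
    unfolding sphere_point_def south_def by (simp add: algebra_simps)
  also have "\<dots> = radial \<theta>"
    unfolding scaleR_add_left[symmetric] by (simp add: power2_eq_square[symmetric])
  finally show ?thesis by simp
qed

lemma frechet_derivative_level_chart:
  "frechet_derivative (level_chart u) (at z) = level_chart_deriv u z"
proof -
  have "(level_chart u has_derivative level_chart_deriv u z) (at z)"
    unfolding level_chart_def level_chart_deriv_def split_beta
    by (rule derivative_eq_intros has_derivative_sphere_point has_derivative_south refl)+
       (simp add: fun_eq_iff radial_frame[of "fst (snd z)" "fst z"] algebra_simps)
  then show ?thesis by (rule frechet_derivative_at[symmetric])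
qed

section \<open>The level in the chart and its tangent spaces\<close>

lemma energy_level_inner:
  "energy_level (\<lambda>_. (\<bullet>)) (u\<^sup>2 / 2) = {(x, v). norm x = 1 \<and> x \<bullet> v = 0 \<and> v \<bullet> v = u\<^sup>2}"
  unfolding energy_level_def energy_def TS2_eq by auto

lemma level_chart_in_level: "range (level_chart u) \<subseteq> energy_level (\<lambda>_. (\<bullet>)) (u\<^sup>2 / 2)"
proof -
  have "u * cos \<psi> * (u * cos \<psi>) + u * sin \<psi> * (u * sin \<psi>) = u\<^sup>2" for \<psi>
    using sin_cos_squared_add[of \<psi>] by algebra
  then show ?thesis
    unfolding energy_level_inner level_chart_def
    by (auto simp: norm_eq_1 inner_add_left inner_add_right frame_orthonormal frame_inner(2) algebra_simps)
qed

text \<open>Differentiating the three equations of the level leaves three free components of a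
  tangent vector, and away from the poles these can be solved for \<open>(a, b, c)\<close>. The
  angle 0 is that of eastward motion.\<close>

lemma level_chart_span:
  assumes "\<xi> \<in> tangent_space (energy_level (\<lambda>_. (\<bullet>)) (u\<^sup>2 / 2)) (level_chart u (s, \<theta>, 0))"
    and "u \<noteq> 0" "sin s \<noteq> 0"
  shows "\<exists>a b c. \<xi> = level_chart_deriv u (s, \<theta>, 0) (a, b, c)"
proof -
  let ?M = "energy_level (\<lambda>_. (\<bullet>)) (u\<^sup>2 / 2)" and ?p = "level_chart u (s, \<theta>, 0)"
  obtain x v where \<xi>: "\<xi> = (x, v)" by fastforce
  have p: "?p = (sphere_point s \<theta>, u *\<^sub>R east \<theta>)" by (simp add: level_chart_def)
  have "((\<lambda>q. fst q \<bullet> fst q) has_derivative (\<lambda>h. fst ?p \<bullet> fst h + fst h \<bullet> fst ?p)) (at ?p)"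
    "((\<lambda>q. fst q \<bullet> snd q) has_derivative (\<lambda>h. fst ?p \<bullet> snd h + fst h \<bullet> snd ?p)) (at ?p)"
    "((\<lambda>q. snd q \<bullet> snd q) has_derivative (\<lambda>h. snd ?p \<bullet> snd h + snd h \<bullet> snd ?p)) (at ?p)"
    by (auto intro!: derivative_eq_intros)
  note z = this[THEN tangent_space_derivative_zero[OF assms(1)]]
  have "x \<bullet> sphere_point s \<theta> = 0" using z(1)[of 1]
    by (auto simp: energy_level_inner \<xi> p inner_commute norm_eq_1)
  moreover have "v \<bullet> sphere_point s \<theta> = - u * (x \<bullet> east \<theta>)" using z(2)[of 0]
    by (auto simp: energy_level_inner \<xi> p inner_commute)
  moreover have "v \<bullet> east \<theta> = 0" using z(3)[of "u\<^sup>2"] \<open>u \<noteq> 0\<close>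
    by (auto simp: energy_level_inner \<xi> p inner_commute)
  \<comment> \<open>The first component \<open>x\<close> gives \<open>a\<close> and
    \<open>b sin s\<close>; the \<open>south\<close> component of \<open>v\<close> is
    \<open>u (c - b cos s)\<close>, which gives \<open>c\<close>.\<close>
  ultimately show ?thesis
    using frame_expand[of x s \<theta>] frame_expand[of v s \<theta>] assms(2,3)
    by (intro exI[of _ "x \<bullet> south s \<theta>"] exI[of _ "(x \<bullet> east \<theta>) / sin s"]
        exI[of _ "(v \<bullet> south s \<theta>) / u + (x \<bullet> east \<theta>) / sin s * cos s"])
       (simp add: \<xi> level_chart_deriv_def algebra_simps)
qed

section \<open>Actions of latitudes\<close>

lemma one_form_liouville: "one_form TS2 (liouville_form (\<lambda>_. (\<bullet>)))"
proof -
  have "linear (liouville_form (\<lambda>_. (\<bullet>)) q)" for q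
    unfolding liouville_form_def by (intro linearI) (simp_all add: inner_add_right)
  moreover have "smooth_on UNIV (\<lambda>q. liouville_form (\<lambda>_. (\<bullet>)) q v)" for v
    unfolding liouville_form_def d\<pi>_eq_fst
    by (intro smooth_on_inner smooth_on_const smooth_on_bounded_linear bounded_linear_snd open_UNIV)
  ultimately show ?thesis
    unfolding one_form_def extends_1form_def by (metis UNIV_I open_UNIV)
qed

text \<open>In the chart the Liouville form is
  \<open>u sin \<psi> ds + u sin s cos \<psi> d\<theta>\<close>, without a \<open>d\<psi>\<close>
  term since fibre directions project to zero. The values are the coefficients of its
  differential.\<close>

lemma d1_liouville_chart:
  defines "\<beta> \<equiv> \<lambda>u z a. liouville_form (\<lambda>_. (\<bullet>)) (level_chart u z) (level_chart_deriv u z a)"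
  shows "d1 (\<beta> u) (s, \<theta>, \<psi>) (1, 0, 0) (0, 1, 0) = u * cos s * cos \<psi>"
    and "d1 (\<beta> u) (s, \<theta>, \<psi>) (1, 0, 0) (0, 0, 1) = - u * cos \<psi>"
    and "d1 (\<beta> u) (s, \<theta>, \<psi>) (0, 1, 0) (0, 0, 1) = u * sin s * sin \<psi>"
proof -
  have \<beta>: "(\<lambda>z. \<beta> u z (1, 0, 0)) = (\<lambda>z. u * sin (snd (snd z)))"
    "(\<lambda>z. \<beta> u z (0, 1, 0)) = (\<lambda>z. u * sin (fst z) * cos (snd (snd z)))"
    "(\<lambda>z. \<beta> u z (0, 0, 1)) = (\<lambda>z. 0)"
    by (auto simp: \<beta>_def liouville_form_def level_chart_def level_chart_deriv_def fun_eq_iff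
        inner_add_left frame_orthonormal frame_inner(2))
  have "((\<lambda>z. u * sin (snd (snd z))) has_derivative (\<lambda>v. u * cos \<psi> * snd (snd v))) (at (s, \<theta>, \<psi>))"
    "((\<lambda>z. u * sin (fst z) * cos (snd (snd z))) has_derivative
      (\<lambda>v. u * cos s * cos \<psi> * fst v - u * sin s * sin \<psi> * snd (snd v))) (at (s, \<theta>, \<psi>))"
    by (auto intro!: derivative_eq_intros)
  note D = this[THEN frechet_derivative_at, symmetric]
  show "d1 (\<beta> u) (s, \<theta>, \<psi>) (1, 0, 0) (0, 1, 0) = u * cos s * cos \<psi>"
    "d1 (\<beta> u) (s, \<theta>, \<psi>) (1, 0, 0) (0, 0, 1) = - u * cos \<psi>"
    "d1 (\<beta> u) (s, \<theta>, \<psi>) (0, 1, 0) (0, 0, 1) = u * sin s * sin \<psi>"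
    unfolding d1_def \<beta> D by simp_all
qed

text \<open>The actions below are computed for an arbitrary primitive on the level of speed
  \<open>u\<close>; the contact condition enters in \<open>not_contact_form\<close>.\<close>

locale magnetic_primitive =
  fixes u :: real and \<tau> :: "R3 \<times> R3 \<Rightarrow> R3 \<times> R3 \<Rightarrow> real" and M :: "(R3 \<times> R3) set"
  defines "M \<equiv> energy_level (\<lambda>_. (\<bullet>)) (u\<^sup>2 / 2)"
  assumes one_form: "one_form M \<tau>"
    and primitive: "\<And>p \<xi> \<eta>. p \<in> M \<Longrightarrow> \<xi> \<in> tangent_space M p \<Longrightarrow> \<eta> \<in> tangent_space M p \<Longrightarrow>
      d1_on M \<tau> p \<xi> \<eta> = d1_on TS2 (liouville_form (\<lambda>_. (\<bullet>))) p \<xi> \<eta> - \<pi>_pullback magnetic_form p \<xi> \<eta>"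
begin

text \<open>The pullback of \<tau> to the parameter space, where \<open>d1\<close> involves no
  choice of extension.\<close>

definition \<beta> :: "real \<times> real \<times> real \<Rightarrow> real \<times> real \<times> real \<Rightarrow> real" where
  "\<beta> z a = \<tau> (level_chart u z) (level_chart_deriv u z a)"

lemma chart_in_M: "range (level_chart u) \<subseteq> M"
  unfolding M_def by (rule level_chart_in_level)

lemma chart_in_TS2: "range (level_chart u) \<subseteq> TS2"
  using chart_in_M by (auto simp: M_def energy_level_def)

lemma chart_tangent: "level_chart_deriv u z a \<in> tangent_space M (level_chart u z)"
  using smooth_map_tangent[OF smooth_level_chart chart_in_M] by (simp add: frechet_derivative_level_chart)

lemma smooth_\<beta>: "smooth_on UNIV (\<lambda>z. \<beta> z a)"
  using smooth_pullback[OF one_form smooth_level_chart chart_in_M]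
  by (simp add: \<beta>_def frechet_derivative_level_chart)

lemma linear_\<beta>: "linear (\<beta> z)"
  using linear_pullback[OF one_form smooth_level_chart chart_in_M]
  by (simp add: \<beta>_def[abs_def] frechet_derivative_level_chart)

lemma d1_on_\<beta>:
  "d1_on M \<tau> (level_chart u z) (level_chart_deriv u z a) (level_chart_deriv u z b) = d1 \<beta> z a b"
  using d1_on_pullback[OF one_form smooth_level_chart chart_in_M]
  by (simp add: \<beta>_def[abs_def] frechet_derivative_level_chart)

text \<open>The chart maps into both the level and \<open>TS2\<close>, so
  \<open>d1_on_pullback\<close> carries both exterior derivatives in the equation
  \<open>primitive\<close> to the parameter space.\<close>

lemma d1_\<beta>:
  "d1 \<beta> z a b = d1 (\<lambda>z a. liouville_form (\<lambda>_. (\<bullet>)) (level_chart u z) (level_chart_deriv u z a)) z a b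
    - magnetic_form (fst (level_chart u z)) (fst (level_chart_deriv u z a)) (fst (level_chart_deriv u z b))"
proof -
  have "level_chart u z \<in> M" using chart_in_M by blast
  from primitive[OF this chart_tangent chart_tangent, of a b] show ?thesis
    unfolding d1_on_\<beta>
    using d1_on_pullback[OF one_form_liouville smooth_level_chart chart_in_TS2]
    by (simp add: frechet_derivative_level_chart \<pi>_pullback_def)
qed

text \<open>The magnetic form pulls back to \<open>magnetic_density (cos s) * sin s\<close> times
  the area element of \<open>s\<close> and \<theta>, and fibre directions do not see it. The second
  value keeps \<psi> free for integration over a fibre.\<close>

lemma d1_\<beta>_values:
  "d1 \<beta> (s, \<theta>, 0) (1, 0, 0) (0, 1, 0) = u * cos s - sin s * magnetic_density (cos s)"
  "d1 \<beta> (s, \<theta>, \<psi>) (1, 0, 0) (0, 0, 1) = - u * cos \<psi>"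
  "d1 \<beta> (s, \<theta>, 0) (0, 1, 0) (0, 0, 1) = 0"
  unfolding d1_\<beta> d1_liouville_chart
  by (simp_all add: level_chart_def level_chart_deriv_def magnetic_form_def sphere_point_3
      cross_mult_right cross_south_east frame_orthonormal)

text \<open>The interval is symmetric so that the reflection in \<open>action_north\<close> maps it
  to itself.\<close>

definition latitude_action :: "real \<Rightarrow> real" where
  "latitude_action s = integral {- pi..pi} (\<lambda>t. \<beta> (s, t, 0) (0, 1, 0))"

definition fibre_action :: "real \<Rightarrow> real" where
  "fibre_action s = integral {- pi..pi} (\<lambda>t. \<beta> (s, 0, t) (0, 0, 1))"

text \<open>Stokes on the cylinder swept out by the latitudes; the integrand is independent of
  longitude, whence the factor \<open>2 * pi\<close>.\<close>

lemma latitude_action_derivative: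
  "(latitude_action has_real_derivative 2 * pi * (u * cos s - sin s * magnetic_density (cos s))) (at s)"
proof -
  have "((\<lambda>s. integral {- pi..pi} (\<lambda>t. \<beta> (0 + s *\<^sub>R (1, 0, 0) + t *\<^sub>R (0, 1, 0)) (0, 1, 0))) has_real_derivative
    integral {- pi..pi} (\<lambda>t. d1 \<beta> (0 + s *\<^sub>R (1, 0, 0) + t *\<^sub>R (0, 1, 0)) (1, 0, 0) (0, 1, 0))) (at s)"
    by (rule cylinder_integral_derivative[OF smooth_\<beta>])
       (simp_all add: zero_prod_def \<beta>_def level_chart_def level_chart_deriv_def frame_defs)
  then show ?thesis
    by (simp add: zero_prod_def d1_\<beta>_values latitude_action_def[abs_def] pi_ge_zero)
qed

text \<open>Above a meridian only the Liouville term \<open>- u cos \<psi>\<close> is left, and it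
  integrates to zero over a period.\<close>

lemma fibre_action_derivative: "(fibre_action has_real_derivative 0) (at s)"
proof -
  have "((\<lambda>s. integral {- pi..pi} (\<lambda>t. \<beta> (0 + s *\<^sub>R (1, 0, 0) + t *\<^sub>R (0, 0, 1)) (0, 0, 1))) has_real_derivative
    integral {- pi..pi} (\<lambda>t. d1 \<beta> (0 + s *\<^sub>R (1, 0, 0) + t *\<^sub>R (0, 0, 1)) (1, 0, 0) (0, 0, 1))) (at s)"
    by (rule cylinder_integral_derivative[OF smooth_\<beta>])
       (simp_all add: zero_prod_def \<beta>_def level_chart_def level_chart_deriv_def)
  moreover have "((\<lambda>t. - u * cos t) has_integral (- u * sin pi) - (- u * sin (- pi))) {- pi..pi}"
    by (rule fundamental_theorem_of_calculus)
       (auto intro!: derivative_eq_intros simp flip: has_real_derivative_iff_has_vector_derivative)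
  ultimately show ?thesis
    by (simp add: zero_prod_def d1_\<beta>_values fibre_action_def[abs_def] integral_unique)
qed

text \<open>At the north pole the velocity in the chart is
  \<open>u east (\<theta> - \<psi>)\<close>: increasing the longitude traces the fibre
  backwards.\<close>

lemma action_north: "latitude_action 0 = - fibre_action 0"
proof -
  have reflect: "\<beta> (0, 0, - t) (0, 0, 1) = - \<beta> (0, t, 0) (0, 1, 0)" for t
  proof -
    have "level_chart u (0, 0, - t) = level_chart u (0, t, 0)"
      "level_chart_deriv u (0, 0, - t) (0, 0, 1) = level_chart_deriv u (0, t, 0) (- (0, 1, 0))"
      by (simp_all add: level_chart_def level_chart_deriv_def frame_defs vec_eq_iff)
    then show ?thesis unfolding \<beta>_def using linear_neg[OF linear_\<beta>, of "(0, t, 0)" "(0, 1, 0)"]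
      by (simp add: \<beta>_def)
  qed
  have "latitude_action 0 = - integral {- pi..pi} (\<lambda>t. \<beta> (0, 0, - t) (0, 0, 1))"
    by (simp only: latitude_action_def reflect Henstock_Kurzweil_Integration.integral_neg minus_minus)
  also have "\<dots> = - fibre_action 0"
    using Henstock_Kurzweil_Integration.integral_reflect_real[where a = "- pi" and b = pi and f = "\<lambda>t. \<beta> (0, 0, t) (0, 0, 1)"]
    by (simp only: fibre_action_def minus_minus)
  finally show ?thesis .
qed

text \<open>Here the velocity is \<open>u east (\<theta> + \<psi>)\<close>, so longitude and angle
  trace the fibre in the same direction.\<close>

lemma action_south: "latitude_action pi = fibre_action pi"
proof -
  have "level_chart u (pi, 0, t) = level_chart u (pi, t, 0)"
    "level_chart_deriv u (pi, 0, t) (0, 0, 1) = level_chart_deriv u (pi, t, 0) (0, 1, 0)" for t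
    by (simp_all add: level_chart_def level_chart_deriv_def frame_defs vec_eq_iff)
  then show ?thesis
    by (simp add: latitude_action_def fibre_action_def \<beta>_def)
qed

text \<open>\<open>G\<close> has the same derivative as the action, which fixes the action up to a
  constant. The polar identities and the constant fibre action give opposite values at 0 and
  \<open>pi\<close>, so the mean of \<open>G\<close> over these two points is subtracted; odd powers
  of the cosine cancel in it and the quartic term leaves \<open>9375 / 4\<close>.\<close>

lemma latitude_action_eq:
  "latitude_action s = 2 * pi * (u * sin s + (31 * cos s + 3125 * (cos s)^3 + 9375 / 4 * (cos s)^4) - 9375 / 4)"
proof -
  define G where "G s = 2 * pi * (u * sin s + (31 * cos s + 3125 * (cos s)^3 + 9375 / 4 * (cos s)^4))" for s
  have "(G has_real_derivative 2 * pi * (u * cos s - sin s * magnetic_density (cos s))) (at s)" for s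
    unfolding G_def[abs_def] magnetic_density_def
    by (auto intro!: derivative_eq_intros simp: power2_eq_square power3_eq_cube algebra_simps)
  from DERIV_diff[OF latitude_action_derivative this]
  have "((\<lambda>s. latitude_action s - G s) has_real_derivative 0) (at s)" for s by simp
  then have c: "latitude_action s - G s = latitude_action t - G t" for s t
    by (rule DERIV_isconst_all[rule_format])
  have "fibre_action pi = fibre_action 0"
    using fibre_action_derivative by (intro DERIV_isconst_all[rule_format])
  then have "latitude_action 0 = - latitude_action pi"
    using action_north action_south by simp
  moreover have "latitude_action pi = latitude_action 0 - G 0 + G pi" using c[of pi 0] by simp
  ultimately have "2 * latitude_action 0 = G 0 - G pi" by simp
  then show ?thesis using c[of s 0] by (simp add: G_def algebra_simps)
qed

lemma not_contact_form:
  assumes u: "u = 2405 * sin s" and s: "cos s = 1 / 5" "sin s > 0"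
  shows "\<not> contact_form M \<tau>"
proof
  assume contact: "contact_form M \<tau>"
  have sin2: "sin s * sin s = 24 / 25"
    using sin_cos_squared_add[of s] s by (simp add: power2_eq_square)
  then have "u * sin s = 11544 / 5" by (simp add: u)
  \<comment> \<open>The terms are 11544/5 + 31/5 + 25 + 15/4 = 9375/4.\<close>
  then have zero: "latitude_action s = 0"
    unfolding latitude_action_eq s(1) by (simp add: power_divide)
  \<comment> \<open>The longitude direction spans the characteristic line here, so the contact
    condition keeps the integrand of the action away from zero.\<close>
  have nz: "\<beta> (s, t, 0) (0, 1, 0) \<noteq> 0" for t
    unfolding \<beta>_def
  proof (rule contact_form_nonzero_on_kernel[OF contact _ chart_tangent chart_tangent chart_tangent])
    let ?L = "level_chart_deriv u (s, t, 0)"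
    show "level_chart u (s, t, 0) \<in> M" using chart_in_M by blast
    \<comment> \<open>The balance \<open>u cos s = sin s * magnetic_density (cos s)\<close>: the
      density at 1/5 is 481 = 2405/5.\<close>
    show "d1_on M \<tau> (level_chart u (s, t, 0)) (?L (0, 1, 0)) (?L (1, 0, 0)) = 0"
      unfolding d1_on_\<beta> d1_skew[of _ _ "(0, 1, 0)" "(1, 0, 0)"] d1_\<beta>_values s(1)
      by (simp add: u magnetic_density_def)
    show "d1_on M \<tau> (level_chart u (s, t, 0)) (?L (0, 1, 0)) (?L (0, 0, 1)) = 0"
      unfolding d1_on_\<beta> d1_\<beta>_values ..
    fix \<xi> assume "\<xi> \<in> tangent_space M (level_chart u (s, t, 0))"
    then obtain a b c where "\<xi> = ?L (a, b, c)"
      using level_chart_span[of \<xi> u s t] u s unfolding M_def by auto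
    then have "\<xi> = b *\<^sub>R ?L (0, 1, 0) + a *\<^sub>R ?L (1, 0, 0) + c *\<^sub>R ?L (0, 0, 1)"
      by (simp add: level_chart_deriv_def algebra_simps)
    then show "\<exists>a b c. \<xi> = a *\<^sub>R ?L (0, 1, 0) + b *\<^sub>R ?L (1, 0, 0) + c *\<^sub>R ?L (0, 0, 1)" by blast
  qed
  define h where "h t = \<beta> (s, t, 0) (0, 1, 0)" for t
  have cont: "continuous_on {- pi..pi} h"
    unfolding h_def[abs_def]
    by (intro continuous_on_compose2[OF smooth_on_imp_continuous_on[OF smooth_\<beta>]] continuous_intros) auto
  \<comment> \<open>The mean value theorem for the running integral of \<open>h\<close> turns the
    vanishing total into a zero of \<open>h\<close>, contradicting \<open>nz\<close>.\<close>
  have "\<exists>t\<in>{- pi<..<pi}. integral {- pi..pi} h - integral {- pi..- pi} h = (pi - - pi) *\<^sub>R h t"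
    using integral_has_vector_derivative[OF cont]
    by (intro mvt_simple) (auto simp: has_vector_derivative_def)
  then show False
    using zero nz by (auto simp: latitude_action_def h_def[abs_def])
qed

end

theorem proposition4p9:
  "\<exists>(g :: real^3 \<Rightarrow> real^3 \<Rightarrow> real^3 \<Rightarrow> real) (\<sigma> :: real^3 \<Rightarrow> real^3 \<Rightarrow> real^3 \<Rightarrow> real) (c :: real).
     riemannian_metric S2 g \<and> symplectic_form S2 \<sigma> \<and> c > 0 \<and> \<not> contact_type g \<sigma> c"
proof -
  \<comment> \<open>The colatitude and, below, the speed for which the latitude is a characteristic
    of zero action; the energy is \<open>u\<^sup>2 / 2\<close>.\<close>
  define s where "s = arccos (1 / 5)"
  have s: "cos s = 1 / 5" "sin s > 0"
    using arccos_lt_bounded[of "1 / 5"] by (auto simp: s_def intro: sin_gt_zero)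
  define u where "u = 2405 * sin s"
  have "\<not> contact_type (\<lambda>_. (\<bullet>)) magnetic_form (u\<^sup>2 / 2)"
  proof
    assume "contact_type (\<lambda>_. (\<bullet>)) magnetic_form (u\<^sup>2 / 2)"
    then obtain \<tau> where "magnetic_primitive u \<tau>" "contact_form (energy_level (\<lambda>_. (\<bullet>)) (u\<^sup>2 / 2)) \<tau>"
      unfolding contact_type_def magnetic_primitive_def by blast
    then show False using magnetic_primitive.not_contact_form u_def s by blast
  qed
  moreover have "u\<^sup>2 / 2 > 0" using s by (simp add: u_def)
  ultimately show ?thesis
    using riemannian_metric_inner symplectic_magnetic_form by blast
qed

end
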